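(* For every loopless matroid $M$ with nonempty ground set, \[H_M(x)=-\sum_{F\in\mathcal{L}(M),\,F\neq\varnothing}\mu(\varnothing,F)\,\bigl(1+x+\cdots+x^{\mathrm{rk}(F)}\bigr)\,H_{M/F}(x).\] Together with $H_M(x)=1$ for the empty matroid, this recursion uniquely determines $M\mapsto H_M(x)$.
   Context: Matroids are on finite ground sets; $\mathrm{rk}$ is the rank function; loopless means every singleton has rank $1$. $\mathcal{L}(M)$ is the lattice of flats with Möbius function $\mu$; $M/F$ is the contraction by the flat $F$. Augmented Chow ring: for loopless $M$ on $E$, $\mathrm{CH}(M)=\mathbb{Q}[x_F,y_i: F\in\mathcal{L}(M)\setminus\{E\},\, i\in E]/(I'+J')$, where $I'$ is generated by $y_i-\sum_{F\not\ni i}x_F$ and $J'$ by $x_{F_1}x_{F_2}$ for incomparable $F_1,F_2$ and by $y_ix_F$ for $i\notin F$; all variables have degree $1$. $H_M(x)=\sum_j\dim_{\mathbb{Q}}\mathrm{CH}^j(M)x^j$. *)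

theory Defs
  imports Main "HOL-Library.Poly_Mapping" "HOL-Computational_Algebra.Formal_Power_Series"
begin

definition matroid :: "'a set \<Rightarrow> ('a set \<Rightarrow> nat) \<Rightarrow> bool" where
  "matroid E rk \<longleftrightarrow> finite E
     \<and> (\<forall>X. X \<subseteq> E \<longrightarrow> rk X \<le> card X)
     \<and> (\<forall>X Y. X \<subseteq> Y \<longrightarrow> Y \<subseteq> E \<longrightarrow> rk X \<le> rk Y)
     \<and> (\<forall>X Y. X \<subseteq> E \<longrightarrow> Y \<subseteq> E \<longrightarrow> rk (X \<union> Y) + rk (X \<inter> Y) \<le> rk X + rk Y)"

definition loopless :: "'a set \<Rightarrow> ('a set \<Rightarrow> nat) \<Rightarrow> bool" where
  "loopless E rk \<longleftrightarrow> (\<forall>i\<in>E. rk {i} = 1)"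

definition flats :: "'a set \<Rightarrow> ('a set \<Rightarrow> nat) \<Rightarrow> 'a set set" where
  "flats E rk = {F. F \<subseteq> E \<and> (\<forall>e\<in>E - F. rk F < rk (insert e F))}"

definition contr_rk :: "('a set \<Rightarrow> nat) \<Rightarrow> 'a set \<Rightarrow> 'a set \<Rightarrow> nat" where
  "contr_rk rk F = (\<lambda>X. rk (X \<union> F) - rk F)"

function mobius :: "'a set set \<Rightarrow> 'a set \<Rightarrow> 'a set \<Rightarrow> int" where
  "mobius L X Y =
     (if X = Y then 1
      else if X \<subset> Y \<and> finite Y then - (\<Sum>Z\<in>{Z\<in>L. X \<subseteq> Z \<and> Z \<subset> Y}. mobius L X Z)
      else 0)"
  by auto
termination
  by (relation "measure (\<lambda>(L, X, Y). card Y)") (auto intro: psubset_card_mono)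

text \<open>Variables: Inl F is x_F, Inr i is y_i. Polynomials over Q are finitely supported
  maps from monomials (finitely supported exponent vectors) to rat.\<close>

type_synonym 'a var = "'a set + 'a"
type_synonym 'a mpoly = "('a var \<Rightarrow>\<^sub>0 nat) \<Rightarrow>\<^sub>0 rat"

definition pvar :: "'a var \<Rightarrow> 'a mpoly" where
  "pvar v = Poly_Mapping.single (Poly_Mapping.single v 1) 1"

definition mdeg :: "('v \<Rightarrow>\<^sub>0 nat) \<Rightarrow> nat" where
  "mdeg m = (\<Sum>v\<in>Poly_Mapping.keys m. Poly_Mapping.lookup m v)"

definition pscale :: "rat \<Rightarrow> 'a mpoly \<Rightarrow> 'a mpoly" where
  "pscale c p = Poly_Mapping.map (\<lambda>a. c * a) p"

definition chow_vars :: "'a set \<Rightarrow> ('a set \<Rightarrow> nat) \<Rightarrow> 'a var set" where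
  "chow_vars E rk = Inl ` (flats E rk - {E}) \<union> Inr ` E"

definition chow_polys :: "'a set \<Rightarrow> ('a set \<Rightarrow> nat) \<Rightarrow> 'a mpoly set" where
  "chow_polys E rk = {p. \<forall>m\<in>Poly_Mapping.keys p. Poly_Mapping.keys m \<subseteq> chow_vars E rk}"

definition chow_polys_deg :: "'a set \<Rightarrow> ('a set \<Rightarrow> nat) \<Rightarrow> nat \<Rightarrow> 'a mpoly set" where
  "chow_polys_deg E rk j = {p \<in> chow_polys E rk. \<forall>m\<in>Poly_Mapping.keys p. mdeg m = j}"

definition chow_gens :: "'a set \<Rightarrow> ('a set \<Rightarrow> nat) \<Rightarrow> 'a mpoly set" where
  "chow_gens E rk =
     {pvar (Inr i) - (\<Sum>F\<in>{F\<in>flats E rk - {E}. i \<notin> F}. pvar (Inl F)) | i. i \<in> E}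
   \<union> {pvar (Inl F1) * pvar (Inl F2) | F1 F2.
        F1 \<in> flats E rk - {E} \<and> F2 \<in> flats E rk - {E} \<and> \<not> F1 \<subseteq> F2 \<and> \<not> F2 \<subseteq> F1}
   \<union> {pvar (Inr i) * pvar (Inl F) | i F. i \<in> E \<and> F \<in> flats E rk - {E} \<and> i \<notin> F}"

definition chow_ideal :: "'a set \<Rightarrow> ('a set \<Rightarrow> nat) \<Rightarrow> 'a mpoly set" where
  "chow_ideal E rk =
     {\<Sum>g\<in>G. a g * g | G a. finite G \<and> G \<subseteq> chow_gens E rk \<and> (\<forall>g\<in>G. a g \<in> chow_polys E rk)}"

text \<open>dim_Q CH^j(M) = dim (degree-j polynomials) - dim (degree-j part of the ideal),
  i.e. the dimension of the quotient of the degree-j piece by the degree-j part of the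
  homogeneous ideal.\<close>
definition chow_dim :: "'a set \<Rightarrow> ('a set \<Rightarrow> nat) \<Rightarrow> nat \<Rightarrow> nat" where
  "chow_dim E rk j =
     vector_space.dim pscale (chow_polys_deg E rk j)
     - vector_space.dim pscale (chow_ideal E rk \<inter> chow_polys_deg E rk j)"

text \<open>Hilbert series H_M(x) (a polynomial, represented as a formal power series).\<close>
definition augH :: "'a set \<Rightarrow> ('a set \<Rightarrow> nat) \<Rightarrow> int fps" where
  "augH E rk = Abs_fps (\<lambda>j. int (chow_dim E rk j))"

definition aug_rec_rhs ::
  "('a set \<Rightarrow> ('a set \<Rightarrow> nat) \<Rightarrow> int fps) \<Rightarrow> 'a set \<Rightarrow> ('a set \<Rightarrow> nat) \<Rightarrow> int fps" where
  "aug_rec_rhs G E rk =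
     - (\<Sum>F\<in>flats E rk - {{}}.
          fps_const (mobius (flats E rk) {} F) * (\<Sum>k\<le>rk F. fps_X ^ k)
          * G (E - F) (contr_rk rk F))"

end

theory Submission
  imports Defs "HOL-Computational_Algebra.Polynomial"
begin

text \<open>
  Put \<open>x_E = - (\<Sum>F \<noteq> E. x_F)\<close> and \<open>z_H = (\<Sum>G \<supseteq> H. x_G)\<close>. In the augmented Chow ring \<open>y_i\<close> is
  \<open>- z_H\<close> for \<open>H\<close> the closure of \<open>i\<close>, and the relations become those of Feichtner and Yuzvinsky:
  \<open>x_F x_G = 0\<close> for incomparable \<open>F, G\<close>, \<open>x_F z_H^(rk H - rk F) = 0\<close> for \<open>F \<subset> H\<close>, and
  \<open>z_H^(rk H + 1) = 0\<close>. The same relations make sense with the variables restricted to an up-set \<open>P\<close>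
  of flats. Adding a new minimal flat \<open>F\<close> to \<open>P\<close> is an algebraic blow-up: the ring \<open>A\<close> of \<open>P\<close> is
  replaced by \<open>A[T]/(T K, (T + z_F)^c)\<close>, where \<open>A/K\<close> is the Chow ring of \<open>M/F\<close> and
  \<open>z_F^c K = 0\<close> in \<open>A\<close>, so that \<open>c - 1\<close> shifted copies of the Chow ring of \<open>M/F\<close> are added.
  This gives a monomial basis, and with it the Hilbert series \<open>C(F)\<close> of the Chow ring of \<open>M/F\<close> and
  \<open>H(F)\<close> of its augmented Chow ring satisfy
  \<open>H(F) = (\<Sum>G \<supseteq> F. x^(rk G - rk F) C(G)) = x (\<Sum>G \<supseteq> F. C(G)) + 1 - x\<close>.
  Moebius inversion of the two expressions yields the same value
  \<open>x C({}) = (\<Sum>F. \<mu>({}, F) x^(rk F + 1) H(F)) = (\<Sum>F. \<mu>({}, F) H(F))\<close>, and dividing the difference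
  by \<open>1 - x\<close> is the recursion.
\<close>

section \<open>Ideals and monomial bases in subrings of a polynomial ring\<close>

text \<open>The number \<open>s\<close> in \<open>flat_gens P s\<close> places a virtual bottom of
  rank \<open>s - 1\<close> below the up-set \<open>P\<close>: the relation
  \<open>z P H ^ (rk H + 1 - s)\<close> is the one for the pair (bottom, \<open>H\<close>) with the
  variable of the bottom removed. For \<open>s = rk F + 1\<close> the bottom is \<open>F\<close>;
  for \<open>s = 0\<close> it has rank -1, one step below the empty flat. A single induction thus
  treats the Chow rings of all contractions and the augmented ring: removing a minimal flat
  \<open>F\<close> leads to \<open>P - {F}\<close> with the same \<open>s\<close>, and to the flats
  above \<open>F\<close> with \<open>s = rk F + 1\<close>. The constant
  \<open>c = rk F + 1 - s\<close> is the rank distance from the bottom to \<open>F\<close>.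
  Semimodularity, with meets staying at or above the virtual bottom, yields both facts needed by the
  blow-up: the old ideal lies in \<open>K\<close>, and \<open>z_F ^ c\<close> sends \<open>K\<close>
  into it. Linear independence is the hard half of a basis theorem. It is obtained by dividing by a
  monic polynomial in the new variable, where remainders are unique. All rings are subrings of one
  polynomial type and quotients appear only as congruences modulo an ideal; this matches the
  definition of the dimension as a difference of two dimensions.\<close>

hide_const (open) Poly_Mapping.degree
abbreviation (input) keys where "keys \<equiv> Poly_Mapping.keys"
abbreviation (input) lookup where "lookup \<equiv> Poly_Mapping.lookup"
abbreviation (input) single where "single \<equiv> Poly_Mapping.single"

section \<open>Polynomials in a given set of variables\<close>

definition Var :: "'v \<Rightarrow> ('v \<Rightarrow>\<^sub>0 nat) \<Rightarrow>\<^sub>0 'k::comm_ring_1" where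
  "Var v = single (single v 1) 1"

definition polys :: "'v set \<Rightarrow> (('v \<Rightarrow>\<^sub>0 nat) \<Rightarrow>\<^sub>0 'k::comm_ring_1) set" where
  "polys V = {p. \<forall>m\<in>keys p. keys m \<subseteq> V}"

lemma keys_add_nat: "keys (m + n) = keys m \<union> keys (n :: 'v \<Rightarrow>\<^sub>0 nat)"
  by (auto simp: in_keys_iff lookup_add)

lemma polys_0 [simp]: "0 \<in> polys V" by (simp add: polys_def)

lemma polys_1 [simp]: "1 \<in> polys V" by (simp add: polys_def)

lemma polys_add: "p \<in> polys V \<Longrightarrow> q \<in> polys V \<Longrightarrow> p + q \<in> polys V"
  unfolding polys_def using keys_add[of p q] by blast

lemma polys_uminus [simp]: "- p \<in> polys V \<longleftrightarrow> p \<in> polys V"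
  by (simp add: polys_def in_keys_iff)

lemma polys_diff: "p \<in> polys V \<Longrightarrow> q \<in> polys V \<Longrightarrow> p - q \<in> polys V"
  using polys_add[of p V "- q"] by simp

lemma polys_mult: "p \<in> polys V \<Longrightarrow> q \<in> polys V \<Longrightarrow> p * q \<in> polys V"
  unfolding polys_def using keys_mult[of p q] by (fastforce simp: keys_add_nat)

lemma polys_power: "p \<in> polys V \<Longrightarrow> p ^ n \<in> polys V"
  by (induction n) (auto simp: polys_mult)

lemma polys_sum: "(\<And>i. i \<in> A \<Longrightarrow> f i \<in> polys V) \<Longrightarrow> sum f A \<in> polys V"
  by (induction A rule: infinite_finite_induct) (auto simp: polys_add)

lemma polys_Var: "v \<in> V \<Longrightarrow> Var v \<in> polys V"
  by (simp add: polys_def Var_def)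

lemma polys_mono: "V \<subseteq> W \<Longrightarrow> polys V \<subseteq> polys W"
  unfolding polys_def by blast

lemma polys_single: "keys m \<subseteq> V \<Longrightarrow> single m c \<in> polys V"
  by (simp add: polys_def)

lemma Var_power: "Var v ^ n = single (single v n) 1"
  by (induction n) (simp_all add: Var_def mult_single flip: Poly_Mapping.single_add)

lemma poly_mapping_sum_singles: "(\<Sum>m\<in>keys p. single m (lookup p m)) = p"
proof (rule poly_mapping_eqI)
  fix k
  have "lookup (\<Sum>m\<in>keys p. single m (lookup p m)) k
      = (\<Sum>m\<in>keys p. if m = k then lookup p k else 0)"
    unfolding lookup_sum by (intro sum.cong) (auto simp: lookup_single when_def)
  then show "lookup (\<Sum>m\<in>keys p. single m (lookup p m)) k = lookup p k"
    by (simp add: in_keys_iff)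
qed

lemma lookup_times_Var_power:
  "lookup (p * Var v ^ n) (m + single v n) = lookup p m"
proof -
  have "p * Var v ^ n = (\<Sum>k\<in>keys p. single (k + single v n) (lookup p k))"
    by (subst poly_mapping_sum_singles[of p, symmetric])
       (simp add: sum_distrib_right mult_single Var_power)
  also have "lookup \<dots> (m + single v n) = (\<Sum>k\<in>keys p. if k = m then lookup p m else 0)"
    unfolding lookup_sum by (intro sum.cong) (auto simp: lookup_single when_def)
  finally show ?thesis by (simp add: in_keys_iff)
qed

lemma keys_times_Var_power:
  "keys (p * Var v ^ n) \<subseteq> (\<lambda>m. m + single v n) ` keys p"
  using keys_mult[of p "Var v ^ n"] by (auto simp: Var_power split: if_splits)

section \<open>Polynomials viewed in one distinguished variable\<close>

definition pcoeffs :: "'v set \<Rightarrow> (('v \<Rightarrow>\<^sub>0 nat) \<Rightarrow>\<^sub>0 'k::comm_ring_1) poly set" where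
  "pcoeffs V = {g. \<forall>i. coeff g i \<in> polys V}"

lemma pcoeffs_0 [simp]: "0 \<in> pcoeffs V" by (simp add: pcoeffs_def)

lemma pcoeffs_pCons [simp]: "pCons a g \<in> pcoeffs V \<longleftrightarrow> a \<in> polys V \<and> g \<in> pcoeffs V"
  by (auto simp: pcoeffs_def coeff_pCons split: nat.splits)

lemma pcoeffs_add: "f \<in> pcoeffs V \<Longrightarrow> g \<in> pcoeffs V \<Longrightarrow> f + g \<in> pcoeffs V"
  by (simp add: pcoeffs_def polys_add)

lemma pcoeffs_diff: "f \<in> pcoeffs V \<Longrightarrow> g \<in> pcoeffs V \<Longrightarrow> f - g \<in> pcoeffs V"
  by (simp add: pcoeffs_def polys_diff)

lemma pcoeffs_mult: "f \<in> pcoeffs V \<Longrightarrow> g \<in> pcoeffs V \<Longrightarrow> f * g \<in> pcoeffs V"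
  by (simp add: pcoeffs_def coeff_mult polys_sum polys_mult)

lemma pcoeffs_smult: "a \<in> polys V \<Longrightarrow> g \<in> pcoeffs V \<Longrightarrow> smult a g \<in> pcoeffs V"
  by (simp add: pcoeffs_def polys_mult)

lemma pcoeffs_power: "f \<in> pcoeffs V \<Longrightarrow> f ^ n \<in> pcoeffs V"
  by (induction n) (auto simp: pcoeffs_mult one_pCons)

lemma pcoeffs_poly: "g \<in> pcoeffs V \<Longrightarrow> a \<in> polys V \<Longrightarrow> poly g a \<in> polys V"
  by (induction g) (auto simp: polys_add polys_mult)

text \<open>Collecting powers of \<open>v\<close> monomial by monomial. Together with
  \<open>poly_Var_inj\<close> this identifies \<open>polys (insert v V)\<close> with univariate
  polynomials over \<open>polys V\<close> when \<open>v\<close> is new, so that degree, leading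
  coefficient and division become available.\<close>

lemma polys_insertE:
  fixes f :: "('v \<Rightarrow>\<^sub>0 nat) \<Rightarrow>\<^sub>0 'k::comm_ring_1"
  assumes "f \<in> polys (insert v V)"
  obtains g where "g \<in> pcoeffs V" "f = poly g (Var v)"
proof -
  have "\<exists>g\<in>pcoeffs V. single m c = poly g (Var v)" if "keys m \<subseteq> insert v V" for m and c :: 'k
  proof -
    define m' where "m' = m - single v (lookup m v)"
    have "m = m' + single v (lookup m v)"
      by (rule poly_mapping_eqI) (simp add: m'_def lookup_add lookup_minus lookup_single when_def)
    then have "single m c = single m' c * Var v ^ lookup m v"
      by (simp add: Var_power mult_single)
    moreover have "keys m' \<subseteq> V"
    proof
      fix u assume "u \<in> keys m'"
      then have "u \<in> keys m \<and> u \<noteq> v"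
        by (cases "u = v") (simp_all add: m'_def in_keys_iff lookup_minus lookup_single)
      with that show "u \<in> V" by blast
    qed
    ultimately show ?thesis
      by (intro bexI[of _ "monom (single m' c) (lookup m v)"])
         (auto simp: poly_monom pcoeffs_def polys_single)
  qed
  then have *: "\<forall>m\<in>keys f. \<exists>g\<in>pcoeffs V. single m (lookup f m) = poly g (Var v)"
    using assms by (auto simp: polys_def)
  then obtain g where g: "\<And>m. m \<in> keys f \<Longrightarrow> g m \<in> pcoeffs V \<and> single m (lookup f m) = poly (g m) (Var v)"
    by metis
  have "f = poly (\<Sum>m\<in>keys f. g m) (Var v)"
    unfolding poly_sum using g
    by (subst poly_mapping_sum_singles[of f, symmetric]) (auto intro!: sum.cong)
  moreover have "(\<Sum>m\<in>keys f. g m) \<in> pcoeffs V"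
    using g by (auto simp: pcoeffs_def coeff_sum intro!: polys_sum)
  ultimately show ?thesis using that by blast
qed

lemma polys_insertI: "g \<in> pcoeffs V \<Longrightarrow> poly g (Var v) \<in> polys (insert v V)"
proof (induction g)
  case (pCons a g)
  then have "a \<in> polys (insert v V)" using polys_mono[of V "insert v V"] by auto
  with pCons show ?case by (auto simp: polys_add polys_mult polys_Var)
qed auto

text \<open>Monomials of \<open>coeff g i\<close> do not involve \<open>v\<close>, so in
  \<open>coeff g i * Var v ^ i\<close> every monomial has \<open>v\<close>-exponent exactly
  \<open>i\<close>. Different \<open>i\<close> contribute disjoint monomials and nothing can
  cancel.\<close>

lemma poly_Var_eq_0:
  assumes "v \<notin> V" "g \<in> pcoeffs V" "poly g (Var v) = 0"
  shows "g = 0"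
proof (rule poly_eqI)
  fix n
  show "coeff g n = coeff 0 n"
  proof (rule ccontr)
    assume "coeff g n \<noteq> coeff 0 n"
    then obtain m where m: "lookup (coeff g n) m \<noteq> 0"
      by (metis coeff_0 lookup_zero poly_mapping_eqI)
    have kV: "v \<notin> keys k" if "lookup (coeff g i) k \<noteq> 0" for i k
    proof -
      have "coeff g i \<in> polys V" "k \<in> keys (coeff g i)"
        using that assms(2) by (simp_all add: pcoeffs_def in_keys_iff)
      then show ?thesis using assms(1) unfolding polys_def by blast
    qed
    have mV: "v \<notin> keys m" using m by (rule kV)
    have "lookup (coeff g i * Var v ^ i) (m + single v n) = (if i = n then lookup (coeff g n) m else 0)" for i
    proof (cases "i = n")
      case False
      have "m + single v n \<notin> keys (coeff g i * Var v ^ i)"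
      proof
        assume "m + single v n \<in> keys (coeff g i * Var v ^ i)"
        then obtain k where k: "k \<in> keys (coeff g i)" "m + single v n = k + single v i"
          using keys_times_Var_power[of "coeff g i" v i] by blast
        from k(1) have "v \<notin> keys k" by (intro kV) (simp add: in_keys_iff)
        with mV have "lookup (m + single v n) v = n" "lookup (k + single v i) v = i"
          by (auto simp: lookup_add in_keys_iff)
        with k(2) False show False by auto
      qed
      then show ?thesis using False by (simp add: in_keys_iff)
    qed (simp add: lookup_times_Var_power)
    then have "lookup (poly g (Var v)) (m + single v n) = lookup (coeff g n) m"
      using m by (auto simp: poly_altdef lookup_sum not_le coeff_eq_0)
    with assms(3) m show False by simp
  qed
qed

lemma poly_Var_inj:
  assumes "v \<notin> V" "f \<in> pcoeffs V" "g \<in> pcoeffs V" "poly f (Var v) = poly g (Var v)"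
  shows "f = g"
  using poly_Var_eq_0[OF assms(1) pcoeffs_diff[OF assms(2,3)]] assms(4) by simp

section \<open>Ideals over a subring and their generators\<close>

definition ideal_in :: "'r::comm_ring_1 set \<Rightarrow> 'r set \<Rightarrow> bool" where
  "ideal_in S I \<longleftrightarrow> 0 \<in> I \<and> (\<forall>a\<in>I. \<forall>b\<in>I. a + b \<in> I) \<and> (\<forall>a\<in>S. \<forall>b\<in>I. a * b \<in> I)"

inductive_set genid :: "'r::comm_ring_1 set \<Rightarrow> 'r set \<Rightarrow> 'r set" for S G where
  zero: "0 \<in> genid S G"
| step: "a \<in> S \<Longrightarrow> g \<in> G \<Longrightarrow> f \<in> genid S G \<Longrightarrow> a * g + f \<in> genid S G"

lemma genid_minimal: "f \<in> genid S G \<Longrightarrow> ideal_in S I \<Longrightarrow> G \<subseteq> I \<Longrightarrow> f \<in> I"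
  by (induction rule: genid.induct) (auto simp: ideal_in_def)

lemma ideal_genid: "ideal_in (polys V) (genid (polys V) G)"
  unfolding ideal_in_def
proof (intro conjI ballI)
  fix a b assume "a \<in> genid (polys V) G" "b \<in> genid (polys V) G"
  then show "a + b \<in> genid (polys V) G"
    by (induction rule: genid.induct) (auto simp: add.assoc intro: genid.step)
next
  fix a b :: "('a \<Rightarrow>\<^sub>0 nat) \<Rightarrow>\<^sub>0 'b" assume a: "a \<in> polys V" and "b \<in> genid (polys V) G"
  from this(2) show "a * b \<in> genid (polys V) G"
    by (induction rule: genid.induct)
       (auto simp: distrib_left mult.assoc[symmetric] intro: genid.intros polys_mult a)
qed (rule genid.zero)

lemma genid_gen: "g \<in> G \<Longrightarrow> g \<in> genid (polys V) G"
  using genid.step[OF polys_1 _ genid.zero, of g G V] by simp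

lemma genid_subset_polys: "G \<subseteq> polys V \<Longrightarrow> genid (polys V) G \<subseteq> polys V"
proof
  fix f assume "f \<in> genid (polys V) G" "G \<subseteq> polys V"
  then show "f \<in> polys V" by (induction rule: genid.induct) (auto simp: polys_add polys_mult)
qed

lemma ideal_in_0: "ideal_in S I \<Longrightarrow> 0 \<in> I"
  and ideal_in_add: "ideal_in S I \<Longrightarrow> a \<in> I \<Longrightarrow> b \<in> I \<Longrightarrow> a + b \<in> I"
  and ideal_in_mult: "ideal_in S I \<Longrightarrow> c \<in> S \<Longrightarrow> a \<in> I \<Longrightarrow> c * a \<in> I"
  by (simp_all add: ideal_in_def)

lemma ideal_in_uminus: "ideal_in (polys V) I \<Longrightarrow> a \<in> I \<Longrightarrow> - a \<in> I"
  using ideal_in_mult[of "polys V" I "- 1" a] by simp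

lemma ideal_in_diff: "ideal_in (polys V) I \<Longrightarrow> a \<in> I \<Longrightarrow> b \<in> I \<Longrightarrow> a - b \<in> I"
  using ideal_in_add[of "polys V" I a "- b"] ideal_in_uminus[of V I b] by simp

lemma ideal_in_sum: "ideal_in S I \<Longrightarrow> (\<And>i. i \<in> A \<Longrightarrow> f i \<in> I) \<Longrightarrow> sum f A \<in> I"
  by (induction A rule: infinite_finite_induct) (auto simp: ideal_in_0 ideal_in_add)

lemma ideal_in_cong: "ideal_in (polys V) I \<Longrightarrow> a - b \<in> I \<Longrightarrow> a \<in> I \<longleftrightarrow> b \<in> I"
  using ideal_in_diff[of V I a "a - b"] ideal_in_add[of "polys V" I "a - b" b] by auto

text \<open>\<open>ideal_in\<close> asks for closure under multiplication by the given subring only,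
  so an ideal over \<open>polys W\<close> is also one over the smaller \<open>polys V\<close>, and
  minimality of \<open>genid\<close> applies to it.\<close>

lemma genid_mono:
  assumes "V \<subseteq> W" "G \<subseteq> genid (polys W) H"
  shows "genid (polys V) G \<subseteq> genid (polys W) H"
proof
  fix f assume "f \<in> genid (polys V) G"
  moreover have "ideal_in (polys V) (genid (polys W) H)"
    using ideal_genid[of W H] polys_mono[OF assms(1)] by (auto simp: ideal_in_def)
  ultimately show "f \<in> genid (polys W) H" using assms(2) genid_minimal by blast
qed

text \<open>Substituting \<open>w\<close> for \<open>v\<close> kills \<open>Var v - w\<close> and
  fixes everything free of \<open>v\<close>. The set \<open>J\<close> is the preimage of the old
  ideal under this substitution.\<close>

lemma linear_adjoin_single:
  assumes v: "v \<notin> V" and G: "G \<subseteq> polys V" and w: "w \<in> polys V"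
    and f: "f \<in> polys V" "f \<in> genid (polys (insert v V)) (insert (Var v - w) G)"
  shows "f \<in> genid (polys V) G"
proof -
  define J where "J = {poly g (Var v) | g. g \<in> pcoeffs V \<and> poly g w \<in> genid (polys V) G}"
  have JI: "f \<in> J" if "g \<in> pcoeffs V" "poly g w \<in> genid (polys V) G" "f = poly g (Var v)" for f g
    using that by (auto simp: J_def)
  have "ideal_in (polys (insert v V)) J"
    unfolding ideal_in_def
  proof (intro conjI ballI)
    show "0 \<in> J" by (rule JI[of 0]) (simp_all add: genid.zero)
    fix b assume "b \<in> J"
    then obtain g where g: "b = poly g (Var v)" "g \<in> pcoeffs V" "poly g w \<in> genid (polys V) G"
      by (auto simp: J_def)
    show "a + b \<in> J" if a: "a \<in> J" for a
    proof -
      obtain h where "a = poly h (Var v)" "h \<in> pcoeffs V" "poly h w \<in> genid (polys V) G"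
        using a by (auto simp: J_def)
      with g show ?thesis
        by (intro JI[of "h + g"]) (simp_all add: pcoeffs_add ideal_in_add[OF ideal_genid])
    qed
    show "a * b \<in> J" if a: "a \<in> polys (insert v V)" for a
    proof -
      obtain h where "h \<in> pcoeffs V" "a = poly h (Var v)" using a by (rule polys_insertE)
      with g show ?thesis
        by (intro JI[of "h * g"]) (simp_all add: pcoeffs_mult ideal_in_mult[OF ideal_genid] pcoeffs_poly w)
    qed
  qed
  moreover have "insert (Var v - w) G \<subseteq> J"
  proof
    fix g assume "g \<in> insert (Var v - w) G"
    then show "g \<in> J"
    proof
      assume "g = Var v - w"
      then show ?thesis using w by (intro JI[of "[:- w, 1:]"]) (simp_all add: genid.zero)
    next
      assume "g \<in> G"
      then show ?thesis using G by (intro JI[of "[:g:]"]) (auto simp: genid_gen)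
    qed
  qed
  ultimately have "f \<in> J" using f(2) genid_minimal by blast
  then obtain g where g: "f = poly g (Var v)" "g \<in> pcoeffs V" "poly g w \<in> genid (polys V) G"
    by (auto simp: J_def)
  with f(1) have "g = [:f:]" by (intro poly_Var_inj[OF v]) simp_all
  with g show ?thesis by simp
qed

text \<open>\<open>Var v - w\<close> divides \<open>poly h (Var v) - poly h w\<close>; the induction
  on \<open>h\<close> is Horner's scheme.\<close>

lemma linear_adjoin_reduce_single:
  assumes w: "w \<in> polys V" and f: "f \<in> polys (insert v V)"
  obtains g where "g \<in> polys V" "f - g \<in> genid (polys (insert v V)) (insert (Var v - w) G)"
proof -
  obtain h where h: "h \<in> pcoeffs V" "f = poly h (Var v)" using f by (rule polys_insertE)
  have "poly h (Var v) - poly h w \<in> genid (polys (insert v V)) (insert (Var v - w) G)" (is "_ \<in> ?I")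
    using h(1)
  proof (induction h)
    case (pCons a h)
    have wv: "w \<in> polys (insert v V)" using w polys_mono[of V "insert v V"] by auto
    have "poly (pCons a h) (Var v) - poly (pCons a h) w
      = poly h (Var v) * (Var v - w) + w * (poly h (Var v) - poly h w)"
      by (simp add: algebra_simps)
    moreover have "poly h (Var v) * (Var v - w) + w * (poly h (Var v) - poly h w) \<in> ?I"
      using pCons wv by (intro genid.step polys_insertI ideal_in_mult[OF ideal_genid]) auto
    ultimately show ?case by simp
  qed (simp add: genid.zero)
  then show ?thesis
    using that[OF pcoeffs_poly[OF h(1) w]] h(2) by simp
qed

text \<open>A variable that is set equal to a polynomial in the other variables can be adjoined
  without changing the quotient ring. Applied twice: with \<open>w = 0\<close> to kill variables,
  and with the linear forms that define the \<open>y_i\<close>.\<close>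

lemma linear_adjoin:
  assumes "finite W" "V \<inter> W = {}" "G \<subseteq> polys V" "\<And>v. v \<in> W \<Longrightarrow> w v \<in> polys V"
  shows "polys V \<inter> genid (polys (V \<union> W)) (G \<union> (\<lambda>v. Var v - w v) ` W) \<subseteq> genid (polys V) G \<and>
    (\<forall>f\<in>polys (V \<union> W). \<exists>g\<in>polys V. f - g \<in> genid (polys (V \<union> W)) (G \<union> (\<lambda>v. Var v - w v) ` W))"
  using assms
proof (induction W)
  case empty
  have "\<exists>g\<in>polys V. f - g \<in> genid (polys V) G" if "f \<in> polys V" for f
    using that by (intro bexI[of _ f]) (simp_all add: genid.zero)
  then show ?case by simp
next
  case (insert v W)
  let ?I = "genid (polys (V \<union> W)) (G \<union> (\<lambda>v. Var v - w v) ` W)"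
  let ?J = "genid (polys (insert v (V \<union> W))) (insert (Var v - w v) (G \<union> (\<lambda>v. Var v - w v) ` W))"
  have IH: "polys V \<inter> ?I \<subseteq> genid (polys V) G" "\<forall>f\<in>polys (V \<union> W). \<exists>g\<in>polys V. f - g \<in> ?I"
    using insert by auto
  have sub: "polys V \<subseteq> polys (V \<union> W)" "\<And>u. u \<in> W \<Longrightarrow> Var u \<in> polys (V \<union> W)"
    by (auto intro: subsetD[OF polys_mono] polys_Var)
  have wV: "w v \<in> polys (V \<union> W)" using insert.prems sub by auto
  have GV: "G \<union> (\<lambda>v. Var v - w v) ` W \<subseteq> polys (V \<union> W)"
    using insert.prems sub by (auto intro!: polys_diff)
  have IJ: "?I \<subseteq> ?J" by (rule genid_mono) (auto intro: genid_gen)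
  have A: "polys V \<inter> ?J \<subseteq> genid (polys V) G"
  proof
    fix f assume f: "f \<in> polys V \<inter> ?J"
    then have "f \<in> ?I"
      using insert.prems insert.hyps sub by (intro linear_adjoin_single[OF _ GV wV]) auto
    with f IH(1) show "f \<in> genid (polys V) G" by auto
  qed
  have B: "\<exists>g\<in>polys V. f - g \<in> ?J" if f: "f \<in> polys (insert v (V \<union> W))" for f
  proof -
    obtain g where g: "g \<in> polys (V \<union> W)" "f - g \<in> ?J"
      by (rule linear_adjoin_reduce_single[OF wV f])
    from bspec[OF IH(2) g(1)] obtain h where h: "h \<in> polys V" "g - h \<in> ?I" by (elim bexE)
    have "f - g + (g - h) \<in> ?J" using g(2) h(2) IJ by (intro ideal_in_add[OF ideal_genid]) auto
    with h(1) show ?thesis by (intro bexI[of _ h]) simp_all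
  qed
  show ?case
    unfolding Un_insert_right image_insert by (intro conjI ballI A B)
qed

section \<open>Monomial bases of quotient rings\<close>

definition monbasis ::
    "'v set \<Rightarrow> (('v \<Rightarrow>\<^sub>0 nat) \<Rightarrow>\<^sub>0 'k::comm_ring_1) set \<Rightarrow> ('v \<Rightarrow>\<^sub>0 nat) set \<Rightarrow> bool" where
  "monbasis V I N \<longleftrightarrow> (\<forall>m\<in>N. keys m \<subseteq> V)
     \<and> (\<forall>f\<in>polys V. \<exists>g. keys g \<subseteq> N \<and> f - g \<in> I)
     \<and> (\<forall>g. keys g \<subseteq> N \<longrightarrow> g \<in> I \<longrightarrow> g = 0)"

lemma monbasisI:
  assumes "\<And>m. m \<in> N \<Longrightarrow> keys m \<subseteq> V"
    and "\<And>f. f \<in> polys V \<Longrightarrow> \<exists>g. keys g \<subseteq> N \<and> f - g \<in> I"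
    and "\<And>g. keys g \<subseteq> N \<Longrightarrow> g \<in> I \<Longrightarrow> g = 0"
  shows "monbasis V I N"
  using assms by (simp add: monbasis_def)

lemma monbasis_vars: "monbasis V I N \<Longrightarrow> m \<in> N \<Longrightarrow> keys m \<subseteq> V"
  by (simp add: monbasis_def)

lemma monbasis_reduce:
  assumes "monbasis V I N" "f \<in> polys V"
  obtains g where "keys g \<subseteq> N" "f - g \<in> I"
proof -
  have "\<exists>g. keys g \<subseteq> N \<and> f - g \<in> I" using assms by (simp add: monbasis_def)
  with that show thesis by blast
qed

lemma monbasis_indep: "monbasis V I N \<Longrightarrow> keys g \<subseteq> N \<Longrightarrow> g \<in> I \<Longrightarrow> g = 0"
  by (simp add: monbasis_def)

lemma monbasis_keys:
  assumes "monbasis V I N" "keys g \<subseteq> N"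
  shows "g \<in> polys V"
proof -
  have "keys m \<subseteq> V" if "m \<in> keys g" for m
    using that assms monbasis_vars[OF assms(1), of m] by auto
  then show ?thesis by (simp add: polys_def)
qed

lemma monbasis_linear_adjoin:
  assumes "monbasis V (genid (polys V) G) N"
    and "finite W" "V \<inter> W = {}" "G \<subseteq> polys V" "\<And>v. v \<in> W \<Longrightarrow> w v \<in> polys V"
  shows "monbasis (V \<union> W) (genid (polys (V \<union> W)) (G \<union> (\<lambda>v. Var v - w v) ` W)) N"
    (is "monbasis _ ?J _")
proof -
  note la = linear_adjoin[where w=w, OF assms(2-5)]
  have IJ: "genid (polys V) G \<subseteq> ?J" by (rule genid_mono) (auto intro: genid_gen)
  show ?thesis
  proof (rule monbasisI)
    show "keys m \<subseteq> V \<union> W" if "m \<in> N" for m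
      using monbasis_vars[OF assms(1) that] by auto
    show "\<exists>g. keys g \<subseteq> N \<and> f - g \<in> ?J" if f: "f \<in> polys (V \<union> W)" for f
    proof -
      from la f obtain h where h: "h \<in> polys V" "f - h \<in> ?J" by auto
      obtain g where g: "keys g \<subseteq> N" "h - g \<in> genid (polys V) G"
        using monbasis_reduce[OF assms(1) h(1)] by blast
      have "f - h + (h - g) \<in> ?J" using h g IJ by (intro ideal_in_add[OF ideal_genid]) auto
      with g(1) show ?thesis by (intro exI[of _ g]) simp
    qed
    show "g = 0" if g: "keys g \<subseteq> N" "g \<in> ?J" for g
    proof -
      have "g \<in> genid (polys V) G" using la g monbasis_keys[OF assms(1) g(1)] by auto
      with monbasis_indep[OF assms(1) g(1)] show ?thesis by simp
    qed
  qed
qed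

lemma monic_division:
  fixes P :: "(('v \<Rightarrow>\<^sub>0 nat) \<Rightarrow>\<^sub>0 'k::comm_ring_1) poly"
  assumes P: "P \<in> pcoeffs V" "degree P = c" "coeff P c = 1" "c \<ge> 1" and h: "h \<in> pcoeffs V"
  shows "\<exists>q\<in>pcoeffs V. \<exists>r\<in>pcoeffs V. h = q * P + r \<and> (\<forall>i\<ge>c. coeff r i = 0)"
  using h
proof (induction h)
  case 0
  show ?case by (intro bexI[of _ 0]) auto
next
  case (pCons a h)
  then obtain q r where qr: "q \<in> pcoeffs V" "r \<in> pcoeffs V" "h = q * P + r" "\<forall>i\<ge>c. coeff r i = 0"
    by auto
  \<comment> \<open>After the shift by \<open>pCons\<close>, the coefficient of the remainder in
    degree \<open>c\<close> is \<open>l\<close>; subtracting \<open>l\<close> times the monic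
    \<open>P\<close> removes it.\<close>
  define l where "l = coeff r (c - 1)"
  have l: "l \<in> polys V" using qr(2) by (simp add: l_def pcoeffs_def)
  have "pCons a h = pCons l q * P + (pCons a r - smult l P)"
    unfolding qr(3) by (simp add: algebra_simps)
  moreover have "coeff (pCons a r - smult l P) i = 0" if "i \<ge> c" for i
    using that qr(4) P by (cases i) (auto simp: l_def coeff_eq_0 le_Suc_eq)
  ultimately show ?case using pCons.prems qr l P(1)
    by (intro bexI[of _ "pCons l q"] bexI[of _ "pCons a r - smult l P"])
       (auto intro!: pcoeffs_diff pcoeffs_smult)
qed

text \<open>If the quotients differed, the leading coefficient of \<open>q - q'\<close> would
  survive in \<open>(q - q') * P\<close> in a degree at least \<open>c\<close>, where both
  remainders vanish. No integrality of the ring is involved because \<open>P\<close> is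
  monic.\<close>

lemma monic_division_unique:
  fixes P :: "'r::comm_ring_1 poly"
  assumes "degree P = c" "coeff P c = 1" "q * P + r = q' * P + r'"
    "\<forall>i\<ge>c. coeff r i = 0" "\<forall>i\<ge>c. coeff r' i = 0"
  shows "r = r'"
proof -
  have eq: "(q - q') * P = r' - r" using assms(3) by (simp add: algebra_simps)
  have "coeff ((q - q') * P) (degree (q - q') + c) = coeff (q - q') (degree (q - q'))"
    using coeff_mult_degree_sum[of "q - q'" P] assms(1,2) by simp
  moreover have "coeff ((q - q') * P) (degree (q - q') + c) = 0"
    unfolding eq using assms(4,5) by simp
  ultimately have "coeff (q - q') (degree (q - q')) = 0" by (simp only:)
  then have "q - q' = 0" by (rule leading_coeff_0_iff[THEN iffD1])
  with eq show ?thesis by simp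
qed

text \<open>This is Keel's description of the Chow ring of a blow-up: adjoining the exceptional divisor
  \<open>T = Var v\<close> with relations \<open>T K = 0\<close> and \<open>P(T) = 0\<close> adds \<open>c - 1\<close> shifted copies of the
  quotient by \<open>K\<close>.\<close>
lemma monbasis_adjoin:
  fixes I K :: "(('v \<Rightarrow>\<^sub>0 nat) \<Rightarrow>\<^sub>0 'k::comm_ring_1) set"
  assumes v: "v \<notin> V"
    and I: "ideal_in (polys V) I" and K: "ideal_in (polys V) K" "I \<subseteq> K" "K \<subseteq> polys V"
    and P: "P \<in> pcoeffs V" "degree P = c" "coeff P c = 1" "c \<ge> 1"
    and PK: "\<And>k. k \<in> K \<Longrightarrow> coeff P 0 * k \<in> I"
    and N: "monbasis V I N" and M: "monbasis V K M"
    and I': "I \<subseteq> genid (polys (insert v V)) G" "poly P (Var v) \<in> genid (polys (insert v V)) G"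
      "\<And>k. k \<in> K \<Longrightarrow> Var v * k \<in> genid (polys (insert v V)) G"
    and G: "\<And>g. g \<in> G \<Longrightarrow> g \<in> I \<or> (\<exists>k\<in>K. g = Var v * k) \<or> g = poly P (Var v)"
  shows "monbasis (insert v V) (genid (polys (insert v V)) G)
    (N \<union> (\<lambda>(a, m). m + single v a) ` ({1..<c} \<times> M))"
proof -
  let ?J = "genid (polys (insert v V)) G"
  let ?T = "Var v :: ('v \<Rightarrow>\<^sub>0 nat) \<Rightarrow>\<^sub>0 'k"
  let ?N = "N \<union> (\<lambda>(a, m). m + single v a) ` ({1..<c} \<times> M)"
  have IV: "I \<subseteq> polys V" using K by auto
  \<comment> \<open>\<open>good\<close> describes the remainders modulo \<open>P\<close> of elements
    of the new ideal: constant coefficient in \<open>I\<close>, all coefficients in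
    \<open>K\<close>, degree below \<open>c\<close>. The proof that \<open>J\<close> is an ideal
    containing \<open>G\<close> bounds the new ideal from above, which is what independence
    needs.\<close>
  define good where "good r \<longleftrightarrow> coeff r 0 \<in> I \<and> (\<forall>i. coeff r i \<in> K) \<and> (\<forall>i\<ge>c. coeff r i = 0)" for r
  define J where "J = {poly (q * P + r) ?T | q r. q \<in> pcoeffs V \<and> good r}"
  have goodV: "r \<in> pcoeffs V" if "good r" for r
    using that K(3) by (auto simp: good_def pcoeffs_def)
  have good_0: "good 0" using ideal_in_0[OF I] ideal_in_0[OF K(1)] by (simp add: good_def)
  have JI: "f \<in> J" if "f = poly (q * P + r) ?T" "q \<in> pcoeffs V" "good r" for f q r
    using that by (auto simp: J_def)
  have J_add: "f + g \<in> J" if fg: "f \<in> J" "g \<in> J" for f g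
  proof -
    obtain q r q' r' where *: "f = poly (q * P + r) ?T" "q \<in> pcoeffs V" "good r"
      "g = poly (q' * P + r') ?T" "q' \<in> pcoeffs V" "good r'"
      using fg unfolding J_def by blast
    moreover have "good (r + r')" using *(3,6) I K(1) by (auto simp: good_def ideal_in_add)
    ultimately show ?thesis
      by (intro JI[of _ "q + q'" "r + r'"]) (auto simp: pcoeffs_add algebra_simps)
  qed
  have J_smult: "a * f \<in> J" if a: "a \<in> polys V" and f: "f \<in> J" for a f
  proof -
    obtain q r where *: "f = poly (q * P + r) ?T" "q \<in> pcoeffs V" "good r"
      using f unfolding J_def by blast
    moreover have "good (smult a r)" using *(3) a I K(1) by (auto simp: good_def ideal_in_mult)
    ultimately show ?thesis using a
      by (intro JI[of _ "smult a q" "smult a r"]) (auto simp: pcoeffs_smult algebra_simps)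
  qed
  have J_T: "?T * f \<in> J" if f: "f \<in> J" for f
  proof -
    obtain q r where *: "f = poly (q * P + r) ?T" "q \<in> pcoeffs V" "good r"
      using f unfolding J_def by blast
    \<comment> \<open>Multiplication by \<open>?T\<close> may push the remainder to degree
      \<open>c\<close>, and it is then reduced by \<open>l\<close> times \<open>P\<close>. The new
      constant coefficient is minus \<open>l\<close> times the constant coefficient of
      \<open>P\<close>, which lies in \<open>I\<close> by \<open>PK\<close>; this is the reason for
      that hypothesis.\<close>
    define l where "l = coeff r (c - 1)"
    have l: "l \<in> K" "l \<in> polys V" using *(3) K(3) by (auto simp: good_def l_def)
    have "good (pCons 0 r - smult l P)"
      unfolding good_def
    proof (intro conjI allI impI)
      show "coeff (pCons 0 r - smult l P) 0 \<in> I"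
        using ideal_in_uminus[OF I PK[OF l(1)]] by (simp add: mult.commute)
      show "coeff (pCons 0 r - smult l P) i \<in> K" for i
        using l(1) *(3) ideal_in_mult[OF K(1) _ l(1), of "coeff P i"] P(1) K(1)
        by (cases i) (auto simp: good_def pcoeffs_def mult.commute ideal_in_uminus intro!: ideal_in_diff)
      show "coeff (pCons 0 r - smult l P) i = 0" if "i \<ge> c" for i
        using that *(3) P by (cases i) (auto simp: good_def l_def coeff_eq_0 le_Suc_eq)
    qed
    moreover have "?T * f = poly (pCons l q * P + (pCons 0 r - smult l P)) ?T"
      using *(1) by (simp add: algebra_simps)
    ultimately show ?thesis using l *(2)
      by (intro JI[of _ "pCons l q" "pCons 0 r - smult l P"]) simp_all
  qed
  have "ideal_in (polys (insert v V)) J"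
    unfolding ideal_in_def
  proof (intro conjI ballI)
    show "0 \<in> J" using good_0 by (intro JI[of _ 0 0]) auto
    show "a + b \<in> J" if "a \<in> J" "b \<in> J" for a b using that by (rule J_add)
    fix a b :: "('v \<Rightarrow>\<^sub>0 nat) \<Rightarrow>\<^sub>0 'k" assume a: "a \<in> polys (insert v V)" and b: "b \<in> J"
    obtain h where h: "h \<in> pcoeffs V" "a = poly h ?T" using a by (rule polys_insertE)
    have "poly h ?T * b \<in> J" using h(1)
    proof (induction h)
      case 0
      then show ?case using good_0 by (auto intro!: JI[of _ 0 0])
    next
      case (pCons a h)
      have "poly (pCons a h) ?T * b = a * b + ?T * (poly h ?T * b)" by (simp add: algebra_simps)
      with pCons show ?case by (auto intro!: J_add J_smult J_T b)
    qed
    with h show "a * b \<in> J" by simp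
  qed
  moreover have I_J: "I \<subseteq> J"
  proof
    fix g assume "g \<in> I"
    then have "good [:g:]" using K P ideal_in_0[OF K(1)]
      by (auto simp: good_def coeff_pCons split: nat.splits)
    then show "g \<in> J" by (intro JI[of _ 0 "[:g:]"]) auto
  qed
  have K_J: "k \<in> J" if "g \<in> K" "k = ?T * g" for g k
  proof (cases "c = 1")
    \<comment> \<open>For \<open>c = 1\<close> the polynomial \<open>T g\<close> is not yet a
      remainder. Since \<open>P = T + P(0)\<close>, dividing gives
      \<open>T g = g P - P(0) g\<close>, and the remainder lies in \<open>I\<close>.\<close>
    case True
    then have c1: "coeff P 1 = 1" "degree P = 1" using P by auto
    then have "P = [:coeff P 0, 1:]"
      by (intro poly_eqI) (auto simp: coeff_pCons coeff_eq_0 split: nat.splits)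
    then have "poly P ?T = coeff P 0 + ?T" by (metis mult.right_neutral poly_pCons poly_0 mult_zero_right add.right_neutral)
    then have "poly ([:g:] * P + [:- (coeff P 0 * g):]) ?T = k" using that by (simp add: algebra_simps)
    moreover have "- (coeff P 0 * g) \<in> I" using PK that I ideal_in_uminus by blast
    then have "good [:- (coeff P 0 * g):]" using K True ideal_in_0[OF K(1)]
      by (auto simp: good_def coeff_pCons split: nat.splits)
    ultimately show ?thesis using that K(3)
      by (intro JI[of _ "[:g:]" "[:- (coeff P 0 * g):]"]) auto
  next
    case False
    then have "good [:0, g:]" using that P(4) ideal_in_0[OF K(1)] ideal_in_0[OF I]
      by (auto simp: good_def coeff_pCons split: nat.splits)
    then show ?thesis using that by (intro JI[of _ 0 "[:0, g:]"]) (auto simp: mult.commute)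
  qed
  have P_J: "poly P ?T \<in> J" using good_0 by (intro JI[of _ 1 0]) (auto simp: one_pCons)
  have "G \<subseteq> J" using G I_J K_J P_J by blast
  ultimately have J: "?J \<subseteq> J" using genid_minimal by blast

  have poly_J: "poly h ?T \<in> ?J" if "\<And>i. ?T ^ i * coeff h i \<in> ?J" for h
    unfolding poly_altdef using that by (auto intro!: ideal_in_sum[OF ideal_genid] simp: mult.commute)
  have "\<exists>g. keys g \<subseteq> ?N \<and> f - g \<in> ?J" if f: "f \<in> polys (insert v V)" for f
  proof -
    obtain h where h: "h \<in> pcoeffs V" "f = poly h ?T" using f by (rule polys_insertE)
    from monic_division[OF P h(1)] obtain q r where
      qr: "q \<in> pcoeffs V" "r \<in> pcoeffs V" "h = q * P + r" "\<forall>i\<ge>c. coeff r i = 0" by blast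
    have rV: "coeff r i \<in> polys V" for i using qr(2) by (simp add: pcoeffs_def)
    \<comment> \<open>The constant coefficient is reduced modulo \<open>I\<close> to the span of
      \<open>N\<close>, the others only modulo \<open>K\<close> to the span of \<open>M\<close>: a
      factor \<open>T\<close> turns elements of \<open>K\<close> into elements of the ideal.\<close>
    obtain n0 where n0: "keys n0 \<subseteq> N" "coeff r 0 - n0 \<in> I"
      using monbasis_reduce[OF N rV] by blast
    have "\<exists>n. keys n \<subseteq> M \<and> coeff r i - n \<in> K" for i using monbasis_reduce[OF M rV] by blast
    then obtain n where n: "\<And>i. keys (n i) \<subseteq> M" "\<And>i. coeff r i - n i \<in> K" by metis
    define g where "g = n0 + (\<Sum>a\<in>{1..<c}. n a * ?T ^ a)"
    have dr: "degree r < c" using qr(4) P(4) by (metis less_le_trans not_le zero_less_one degree_0 leading_coeff_0_iff)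
    have "poly r ?T = (\<Sum>a<c. coeff r a * ?T ^ a)"
      unfolding poly_altdef using dr by (intro sum.mono_neutral_left) (auto simp: coeff_eq_0)
    also have "{..<c} = insert 0 {1..<c}" using P(4) by auto
    also have "(\<Sum>a\<in>insert 0 {1..<c}. coeff r a * ?T ^ a) = coeff r 0 + (\<Sum>a\<in>{1..<c}. coeff r a * ?T ^ a)"
      by simp
    finally have "f - g = poly q ?T * poly P ?T + ((coeff r 0 - n0)
       + (\<Sum>a\<in>{1..<c}. (coeff r a - n a) * ?T ^ a))"
      unfolding h(2) qr(3) g_def by (simp add: algebra_simps sum_subtractf)
    also have "\<dots> \<in> ?J"
    proof (intro ideal_in_add[OF ideal_genid] ideal_in_sum[OF ideal_genid])
      show "poly q ?T * poly P ?T \<in> ?J"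
        using I'(2) qr(1) by (intro ideal_in_mult[OF ideal_genid] polys_insertI)
      show "coeff r 0 - n0 \<in> ?J" using n0 I' by auto
      fix a assume "a \<in> {1..<c}"
      then obtain b where b: "a = Suc b" by (cases a) auto
      have "?T ^ b * (?T * (coeff r a - n a)) \<in> ?J"
        by (intro ideal_in_mult[OF ideal_genid] polys_power polys_Var I' n) auto
      then show "(coeff r a - n a) * ?T ^ a \<in> ?J" by (simp add: b algebra_simps)
    qed
    finally have "f - g \<in> ?J" .
    moreover have "keys (n a * ?T ^ a) \<subseteq> ?N" if "a \<in> {1..<c}" for a
      using keys_times_Var_power[of "n a" v a] n(1)[of a] that by force
    then have "keys (\<Sum>a\<in>{1..<c}. n a * ?T ^ a) \<subseteq> ?N"
      using keys_sum[of "\<lambda>a. n a * ?T ^ a" "{1..<c}"] by blast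
    then have "keys g \<subseteq> ?N"
      using n0(1) keys_add[of n0] unfolding g_def by (meson le_supI1 order_trans Un_least)
    ultimately show ?thesis by blast
  qed
  moreover have "g = 0" if g: "keys g \<subseteq> ?N" "g \<in> ?J" for g
  proof -
    have "g \<in> J" using g J by auto
    then obtain q r where qr: "g = poly (q * P + r) ?T" "q \<in> pcoeffs V" "good r"
      unfolding J_def by blast
    \<comment> \<open>A combination of the proposed monomials is, as a polynomial in
      \<open>T\<close>, already a remainder. By uniqueness it equals the \<open>good\<close>
      remainder, and independence can be tested coefficient by coefficient.\<close>
    define good' where "good' h \<longleftrightarrow> keys (coeff h 0) \<subseteq> N \<and> (\<forall>i\<ge>1. keys (coeff h i) \<subseteq> M) \<and> (\<forall>i\<ge>c. coeff h i = 0)" for h :: "(('v \<Rightarrow>\<^sub>0 nat) \<Rightarrow>\<^sub>0 'k) poly"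
    have good'_sum: "good' (\<Sum>m\<in>A. u m)" if "\<And>m. m \<in> A \<Longrightarrow> good' (u m)" for A and u :: "('v \<Rightarrow>\<^sub>0 nat) \<Rightarrow> _"
      using that unfolding good'_def coeff_sum
      by (intro conjI allI impI sum.neutral order_trans[OF keys_sum] UN_least) auto
    have "\<exists>h. good' h \<and> single m (lookup g m) = poly h ?T" if "m \<in> keys g" for m
    proof -
      from that g(1) have "m \<in> ?N" by blast
      then consider "m \<in> N" | a k where "a \<in> {1..<c}" "k \<in> M" "m = k + single v a" by auto
      then show ?thesis
      proof cases
        case 1
        then show ?thesis using P(4)
          by (intro exI[of _ "[:single m (lookup g m):]"]) (auto simp: good'_def coeff_pCons split: nat.splits)
      next
        case 2
        then show ?thesis
          by (intro exI[of _ "monom (single k (lookup g m)) a"])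
             (auto simp: good'_def poly_monom Var_power mult_single)
      qed
    qed
    then obtain u where u: "\<And>m. m \<in> keys g \<Longrightarrow> good' (u m) \<and> single m (lookup g m) = poly (u m) ?T"
      by metis
    define h where "h = (\<Sum>m\<in>keys g. u m)"
    have h: "good' h" unfolding h_def using u by (intro good'_sum) auto
    have gh: "g = poly h ?T" unfolding h_def poly_sum using u
      by (subst poly_mapping_sum_singles[of g, symmetric]) (auto intro!: sum.cong)
    have hV: "coeff h i \<in> polys V" for i
      using h monbasis_keys[OF N, of "coeff h 0"] monbasis_keys[OF M, of "coeff h i"]
      by (cases i) (auto simp: good'_def)
    have "h \<in> pcoeffs V" using hV by (simp add: pcoeffs_def)
    then have "h = q * P + r"
      by (rule poly_Var_inj[OF v]) (use gh qr goodV P(1) in \<open>auto intro!: pcoeffs_add pcoeffs_mult\<close>)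
    then have "h = r"
      using monic_division_unique[OF P(2,3), of q r 0 h] h qr(3) by (auto simp: good_def good'_def)
    have "coeff h i = 0" for i
    proof (cases "i = 0")
      case True
      have "keys (coeff h 0) \<subseteq> N" using h by (simp add: good'_def)
      moreover have "coeff h 0 \<in> I" using qr(3) by (simp add: good_def \<open>h = r\<close>)
      ultimately show ?thesis using True monbasis_indep[OF N] by simp
    next
      case False
      then have "keys (coeff h i) \<subseteq> M" "coeff h i \<in> K"
        using h qr(3) by (auto simp: good_def good'_def \<open>h = r\<close>)
      then show ?thesis using monbasis_indep[OF M] by simp
    qed
    then have "h = 0" by (intro poly_eqI) auto
    with gh show ?thesis by simp
  qed
  moreover have "keys m \<subseteq> insert v V" if "m \<in> ?N" for m
    using that monbasis_vars[OF N, of m] monbasis_vars[OF M]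
    by (fastforce simp: keys_add_nat split: if_splits)
  ultimately show ?thesis by (intro monbasisI)
qed

text \<open>The Hilbert series of the Chow ring of \<open>M/F\<close>.\<close>
function chow_series :: "'a set \<Rightarrow> ('a set \<Rightarrow> nat) \<Rightarrow> 'a set \<Rightarrow> int fps" where
  "chow_series E rk F = (if finite E
     then 1 + (\<Sum>G\<in>{G \<in> flats E rk. F \<subset> G}. (\<Sum>a\<in>{1..<rk G - rk F}. fps_X ^ a) * chow_series E rk G)
     else 0)"
  by auto
termination
proof (relation "measure (\<lambda>(E, rk, F). card (E - F))")
  fix E :: "'a set" and rk F G
  assume "finite E" "G \<in> {G \<in> flats E rk. F \<subset> G}"
  then show "((E, rk, G), (E, rk, F)) \<in> measure (\<lambda>(E, rk, F). card (E - F))"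
    by (auto simp: flats_def intro!: psubset_card_mono)
qed simp

declare chow_series.simps [simp del]

section \<open>Degrees of monomials and powers modulo an ideal\<close>

lemma mdeg_superset:
  assumes "finite A" "keys m \<subseteq> A"
  shows "mdeg m = (\<Sum>v\<in>A. lookup m v)"
  unfolding mdeg_def using assms by (intro sum.mono_neutral_left) (auto simp: in_keys_iff)

lemma mdeg_0 [simp]: "mdeg 0 = 0" by (simp add: mdeg_def)

lemma mdeg_add: "mdeg (m + n) = mdeg m + mdeg n"
  by (simp add: mdeg_superset[of "keys m \<union> keys n"] keys_add_nat lookup_add sum.distrib)

lemma mdeg_single [simp]: "mdeg (single v a) = a"
  by (simp add: mdeg_def)

lemma ideal_power_mono:
  assumes "ideal_in (polys V) I" "z \<in> polys V" "a * z ^ m \<in> I" "m \<le> n"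
  shows "a * z ^ n \<in> I"
proof -
  have "z ^ (n - m) * (a * z ^ m) \<in> I" 
    by (rule ideal_in_mult[OF assms(1) polys_power[OF assms(2)] assms(3)])
  also have "z ^ (n - m) * (a * z ^ m) = a * z ^ n"
    using assms(4) by (simp add: algebra_simps flip: power_add)
  finally show ?thesis .
qed

text \<open>\<open>u - w\<close> divides \<open>u ^ n - w ^ n\<close>. This allows
  \<open>z_H\<close> to be exchanged for \<open>z\<close> of a join inside a power.\<close>

lemma ideal_power_cong:
  assumes I: "ideal_in (polys V) I" and "u \<in> polys V" "w \<in> polys V" and uw: "a * (u - w) \<in> I"
  shows "a * u ^ n \<in> I \<longleftrightarrow> a * w ^ n \<in> I"
proof (rule ideal_in_cong[OF I])
  show "a * u ^ n - a * w ^ n \<in> I"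
  proof (induction n)
    case (Suc n)
    have "u * (a * u ^ n - a * w ^ n) + w ^ n * (a * (u - w)) \<in> I"
      by (intro ideal_in_add[OF I] ideal_in_mult[OF I] Suc assms polys_power)
    then show ?case by (simp add: algebra_simps)
  qed (simp add: ideal_in_0[OF I])
qed

text \<open>Annihilation statements such as \<open>z_F ^ c K = 0\<close> can therefore be checked on
  generators of \<open>K\<close>.\<close>

lemma ideal_colon:
  assumes "ideal_in (polys V) I" "W \<subseteq> V"
  shows "ideal_in (polys W) {k. p * k \<in> I}"
  using assms(1) polys_mono[OF assms(2)]
  unfolding ideal_in_def by (auto simp: distrib_left mult.left_commute[of p])

lemma monbasis_empty: 
  "monbasis {} (genid (polys {}) {} :: (('v \<Rightarrow>\<^sub>0 nat) \<Rightarrow>\<^sub>0 'k::comm_ring_1) set) {0}"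
proof (rule monbasisI)
  fix f :: "('v \<Rightarrow>\<^sub>0 nat) \<Rightarrow>\<^sub>0 'k::comm_ring_1" assume "f \<in> polys {}"
  then have "keys f \<subseteq> {0}" by (auto simp: polys_def)
  then show "\<exists>g. keys g \<subseteq> {0} \<and> f - g \<in> genid (polys {}) {}"
    by (intro exI[of _ f]) (simp add: genid.zero)
next
  fix g :: "('v \<Rightarrow>\<^sub>0 nat) \<Rightarrow>\<^sub>0 'k" assume "g \<in> genid (polys {}) {}"
  then show "g = 0" by cases auto
qed auto

section \<open>Flats\<close>

locale loopless_matroid =
  fixes E :: "'a set" and rk :: "'a set \<Rightarrow> nat"
  assumes matroid: "matroid E rk" and loopless: "loopless E rk"
begin

abbreviation L where "L \<equiv> flats E rk"

definition cl where "cl X = {e \<in> E. rk (insert e X) = rk X}"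

lemma finite_E: "finite E" using matroid by (simp add: matroid_def)

lemma rk_mono: "X \<subseteq> Y \<Longrightarrow> Y \<subseteq> E \<Longrightarrow> rk X \<le> rk Y"
  using matroid by (simp add: matroid_def)

lemma submod: "X \<subseteq> E \<Longrightarrow> Y \<subseteq> E \<Longrightarrow> rk (X \<union> Y) + rk (X \<inter> Y) \<le> rk X + rk Y"
  using matroid by (simp add: matroid_def)

lemma rk_empty [simp]: "rk {} = 0"
  using matroid by (auto simp: matroid_def)

lemma flat_subset: "F \<in> L \<Longrightarrow> F \<subseteq> E" by (simp add: flats_def)

lemma finite_L: "finite L"
  by (rule finite_subset[of _ "Pow E"]) (auto simp: flats_def finite_E)

lemma E_flat: "E \<in> L" by (simp add: flats_def)

lemma empty_flat: "{} \<in> L" using loopless by (simp add: flats_def loopless_def)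

lemma flat_rk_less:
  assumes "F \<in> L" "G \<in> L" "F \<subset> G"
  shows "rk F < rk G"
proof -
  obtain e where "e \<in> G" "e \<notin> F" using assms(3) by blast
  then have "rk F < rk (insert e F)" "insert e F \<subseteq> G"
    using assms by (auto simp: flats_def)
  with rk_mono[of "insert e F" G] flat_subset[OF assms(2)] show ?thesis by simp
qed

lemma flat_rk_le: "F \<subseteq> G \<Longrightarrow> G \<in> L \<Longrightarrow> rk F \<le> rk G"
  by (simp add: rk_mono flat_subset)

lemma cl_subset: "cl X \<subseteq> E" by (auto simp: cl_def)

lemma subset_cl: "X \<subseteq> E \<Longrightarrow> X \<subseteq> cl X" by (auto simp: cl_def insert_absorb)

text \<open>The elements of the closure are added one at a time; by submodularity an element that
  does not raise the rank of \<open>X\<close> does not raise that of a larger set of the same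
  rank.\<close>

lemma rk_cl:
  assumes X: "X \<subseteq> E"
  shows "rk (cl X) = rk X"
proof -
  have "rk (X \<union> S) = rk X" if "finite S" "S \<subseteq> cl X" for S
    using that
  proof (induction S)
    case (insert e S)
    then have e: "e \<in> E" "rk (insert e X) = rk X" and S: "S \<subseteq> E" "rk (X \<union> S) = rk X"
      using cl_subset by (auto simp: cl_def)
    have "rk ((X \<union> S) \<union> insert e X) + rk ((X \<union> S) \<inter> insert e X) \<le> rk (X \<union> S) + rk (insert e X)"
      using e S X by (intro submod) auto
    moreover have "rk X \<le> rk ((X \<union> S) \<inter> insert e X)" using e S X by (intro rk_mono) auto
    moreover have "(X \<union> S) \<union> insert e X = X \<union> insert e S" by auto
    moreover have "rk X \<le> rk (X \<union> insert e S)" using e S X by (intro rk_mono) auto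
    ultimately show ?case using e S by simp
  qed simp
  from this[of "cl X"] show ?thesis
    using finite_subset[OF cl_subset finite_E] subset_cl[OF X] by (simp add: Un_absorb1)
qed

lemma cl_flat:
  assumes X: "X \<subseteq> E"
  shows "cl X \<in> L"
  unfolding flats_def
proof (intro CollectI conjI ballI cl_subset)
  fix e assume e: "e \<in> E - cl X"
  then have "rk X \<noteq> rk (insert e X)" by (auto simp: cl_def)
  moreover have "rk X \<le> rk (insert e X)" using e X by (intro rk_mono) auto
  moreover have "rk (insert e X) \<le> rk (insert e (cl X))"
    using e subset_cl[OF X] cl_subset by (intro rk_mono) auto
  ultimately show "rk (cl X) < rk (insert e (cl X))" by (simp add: rk_cl[OF X])
qed

text \<open>By submodularity an element outside \<open>F\<close> would raise the rank of
  \<open>F\<close> by no more than that of \<open>X\<close>, that is, not at all, contradicting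
  flatness.\<close>

lemma cl_minimal:
  assumes F: "F \<in> L" "X \<subseteq> F"
  shows "cl X \<subseteq> F"
proof
  fix e assume e: "e \<in> cl X"
  show "e \<in> F"
  proof (rule ccontr)
    assume eF: "e \<notin> F"
    have FE: "F \<subseteq> E" "X \<subseteq> E" using F flat_subset by auto
    have e': "e \<in> E" "rk (insert e X) = rk X" using e by (auto simp: cl_def)
    have "rk F < rk (insert e F)" using F eF e' by (simp add: flats_def)
    moreover have "rk (F \<union> insert e X) + rk (F \<inter> insert e X) \<le> rk F + rk (insert e X)"
      using FE e' by (intro submod) auto
    moreover have "F \<union> insert e X = insert e F" "F \<inter> insert e X = X" using F eF by auto
    ultimately show False using e' by simp
  qed
qed

lemma flat_Int:
  assumes "F \<in> L" "G \<in> L"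
  shows "F \<inter> G \<in> L"
proof -
  have "cl (F \<inter> G) = F \<inter> G"
    using cl_minimal[OF assms(1), of "F \<inter> G"] cl_minimal[OF assms(2), of "F \<inter> G"]
      subset_cl[of "F \<inter> G"] flat_subset[OF assms(1)] by auto
  with cl_flat[of "F \<inter> G"] flat_subset[OF assms(1)] show ?thesis by auto
qed

text \<open>The closure of the union is the join in the lattice of flats. The fourth claim,
  semimodularity, is the source of every exponent estimate below.\<close>

lemma join_flat:
  assumes "A \<in> L" "B \<in> L"
  shows "cl (A \<union> B) \<in> L" "A \<subseteq> cl (A \<union> B)" "B \<subseteq> cl (A \<union> B)"
    "rk (cl (A \<union> B)) + rk (A \<inter> B) \<le> rk A + rk B"
    "G \<in> L \<Longrightarrow> cl (A \<union> B) \<subseteq> G \<longleftrightarrow> A \<subseteq> G \<and> B \<subseteq> G"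
proof -
  have AB: "A \<union> B \<subseteq> E" using assms flat_subset by auto
  show "cl (A \<union> B) \<in> L" by (rule cl_flat[OF AB])
  show s: "A \<subseteq> cl (A \<union> B)" "B \<subseteq> cl (A \<union> B)" using subset_cl[OF AB] by auto
  show "rk (cl (A \<union> B)) + rk (A \<inter> B) \<le> rk A + rk B"
    using submod[of A B] AB by (simp add: rk_cl)
  show "cl (A \<union> B) \<subseteq> G \<longleftrightarrow> A \<subseteq> G \<and> B \<subseteq> G" if "G \<in> L"
    using s cl_minimal[OF that, of "A \<union> B"] by auto
qed

section \<open>Rings attached to up-sets of flats\<close>

definition upset :: "'a set set \<Rightarrow> bool" where
  "upset P \<longleftrightarrow> P \<subseteq> L \<and> (\<forall>F\<in>P. \<forall>G\<in>L. F \<subseteq> G \<longrightarrow> G \<in> P)"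

definition xv :: "'a set \<Rightarrow> 'a mpoly" where "xv F = Var (Inl F)"

definition z :: "'a set set \<Rightarrow> 'a set \<Rightarrow> 'a mpoly" where
  "z P H = (\<Sum>G\<in>{G \<in> P. H \<subseteq> G}. xv G)"

definition incomp_gens :: "'a set set \<Rightarrow> 'a mpoly set" where
  "incomp_gens P = {xv F * xv G | F G. F \<in> P \<and> G \<in> P \<and> \<not> F \<subseteq> G \<and> \<not> G \<subseteq> F}"

definition rel_gens :: "'a set set \<Rightarrow> 'a mpoly set" where
  "rel_gens P = {xv F * z P H ^ (rk H - rk F) | F H. F \<in> P \<and> H \<in> P \<and> F \<subset> H}"

text \<open>For \<open>P = L, s = 0\<close> the quotient is the augmented Chow ring; for \<open>P = {G. F \<subset> G}, s = rk F + 1\<close>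
  it is the Chow ring of \<open>M/F\<close>.\<close>
definition flat_gens :: "'a set set \<Rightarrow> nat \<Rightarrow> 'a mpoly set" where
  "flat_gens P s = incomp_gens P \<union> rel_gens P \<union> {z P H ^ (rk H + 1 - s) | H. H \<in> P}"

abbreviation flat_ideal :: "'a set set \<Rightarrow> nat \<Rightarrow> 'a mpoly set" where
  "flat_ideal P s \<equiv> genid (polys (Inl ` P)) (flat_gens P s)"

lemma upset_finite: "upset P \<Longrightarrow> finite P"
  using finite_subset[OF _ finite_L] by (auto simp: upset_def)

lemma upset_flat: "upset P \<Longrightarrow> F \<in> P \<Longrightarrow> F \<in> L"
  by (auto simp: upset_def)

lemma upset_up: "upset P \<Longrightarrow> F \<in> P \<Longrightarrow> G \<in> L \<Longrightarrow> F \<subseteq> G \<Longrightarrow> G \<in> P"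
  by (auto simp: upset_def)

lemma upset_L: "upset L" by (simp add: upset_def)

lemma upset_above: "upset {G \<in> L. F \<subset> G}" by (auto simp: upset_def)

lemma x_polys: "F \<in> P \<Longrightarrow> Inl ` P \<subseteq> V \<Longrightarrow> xv F \<in> polys V"
  by (auto simp: xv_def intro!: polys_Var)

lemma z_polys: "Inl ` P \<subseteq> V \<Longrightarrow> z P H \<in> polys V"
  unfolding z_def by (intro polys_sum x_polys[of _ P]) auto

lemma flat_gens_polys: "flat_gens P s \<subseteq> polys (Inl ` P)"
  by (auto simp: flat_gens_def incomp_gens_def rel_gens_def
      intro!: polys_mult polys_power x_polys[of _ P] z_polys)

text \<open>Only flats above \<open>H\<close> occur in \<open>z_H\<close>, so it stays the same
  while the up-set grows. The exception to watch is \<open>z P F\<close> for a flat \<open>F\<close>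
  not yet in \<open>P\<close>.\<close>

lemma z_upset:
  assumes "upset P" "H \<in> P"
  shows "z P H = z L H"
proof -
  have "{G \<in> P. H \<subseteq> G} = {G \<in> L. H \<subseteq> G}" using assms by (auto simp: upset_def)
  then show ?thesis by (simp add: z_def)
qed

text \<open>\<open>x_A\<close> kills every \<open>x_G\<close> with \<open>G\<close> incomparable to
  \<open>A\<close>. As \<open>H\<close> is not below \<open>A\<close>, no \<open>G\<close> above
  \<open>H\<close> lies below \<open>A\<close>, so only those above the join of \<open>A\<close> and
  \<open>H\<close> survive.\<close>

lemma x_times_z_join:
  assumes P: "upset P" and I: "ideal_in (polys V) I" "incomp_gens P \<subseteq> I"
    and A: "A \<in> P" and H: "H \<in> L" "\<not> H \<subseteq> A"
  shows "xv A * (z P H - z P (cl (A \<union> H))) \<in> I"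
proof -
  have AL: "A \<in> L" using upset_flat[OF P A] .
  have fP: "finite P" by (rule upset_finite[OF P])
  let ?J = "cl (A \<union> H)"
  have sub: "{G \<in> P. ?J \<subseteq> G} \<subseteq> {G \<in> P. H \<subseteq> G}" using join_flat(3)[OF AL H(1)] by auto
  have "z P H - z P ?J = (\<Sum>G\<in>{G \<in> P. H \<subseteq> G} - {G \<in> P. ?J \<subseteq> G}. xv G)"
    unfolding z_def using sub fP by (subst sum_diff) auto
  then have "xv A * (z P H - z P ?J) = (\<Sum>G\<in>{G \<in> P. H \<subseteq> G} - {G \<in> P. ?J \<subseteq> G}. xv A * xv G)"
    by (simp add: sum_distrib_left)
  also have "\<dots> \<in> I"
  proof (rule ideal_in_sum[OF I(1)])
    fix G assume "G \<in> {G \<in> P. H \<subseteq> G} - {G \<in> P. ?J \<subseteq> G}"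
    then have G: "G \<in> P" "H \<subseteq> G" "\<not> ?J \<subseteq> G" by auto
    have "\<not> A \<subseteq> G" using G join_flat(5)[OF AL H(1) upset_flat[OF P G(1)]] by auto
    moreover have "\<not> G \<subseteq> A" using G H by auto
    ultimately have "xv A * xv G \<in> incomp_gens P" unfolding incomp_gens_def using A G by blast
    with I(2) show "xv A * xv G \<in> I" by auto
  qed
  finally show ?thesis .
qed

text \<open>The relation for the pair \<open>A\<close> and its join with \<open>H\<close> has
  exponent at most \<open>n\<close> by semimodularity. The flat \<open>H\<close> may lie outside
  \<open>P\<close>, as it does when it is the flat about to be added.\<close>

lemma x_times_z_power:
  assumes P: "upset P" and I: "ideal_in (polys V) I" "incomp_gens P \<subseteq> I" "rel_gens P \<subseteq> I"
    and V: "Inl ` P \<subseteq> V"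
    and A: "A \<in> P" and H: "H \<in> L" "\<not> H \<subseteq> A" and n: "rk H \<le> n + rk (A \<inter> H)"
  shows "xv A * z P H ^ n \<in> I"
proof -
  let ?J = "cl (A \<union> H)"
  have AL: "A \<in> L" using upset_flat[OF P A] .
  note J = join_flat[OF AL H(1)]
  have AJ: "A \<subset> ?J" using J(2,3) H(2) by auto
  have JP: "?J \<in> P" using upset_up[OF P A J(1,2)] .
  have "xv A * z P ?J ^ (rk ?J - rk A) \<in> I" using I(3) A JP AJ by (auto simp: rel_gens_def)
  moreover have "rk ?J - rk A \<le> n" using J(4) n by simp
  ultimately have "xv A * z P ?J ^ n \<in> I"
    using ideal_power_mono[OF I(1) z_polys[OF V]] by blast
  then show ?thesis
    using ideal_power_cong[OF I(1) z_polys[OF V] z_polys[OF V] x_times_z_join[OF P I(1,2) A H]] by simp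
qed

lemma flat_ideal_gens: "incomp_gens P \<subseteq> flat_ideal P s" "rel_gens P \<subseteq> flat_ideal P s"
  "H \<in> P \<Longrightarrow> z P H ^ (rk H + 1 - s) \<in> flat_ideal P s"
  by (auto simp: flat_gens_def intro!: genid_gen)

lemma incomp_gens_mono: "P \<subseteq> Q \<Longrightarrow> incomp_gens P \<subseteq> incomp_gens Q"
  by (auto simp: incomp_gens_def)

lemma rel_gens_mono:
  assumes "upset P" "upset Q" "P \<subseteq> Q"
  shows "rel_gens P \<subseteq> rel_gens Q"
proof
  fix g assume "g \<in> rel_gens P"
  then obtain F H where g: "g = xv F * z P H ^ (rk H - rk F)" "F \<in> P" "H \<in> P" "F \<subset> H"
    by (auto simp: rel_gens_def)
  moreover have "z P H = z Q H" using z_upset assms g(3) by auto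
  ultimately show "g \<in> rel_gens Q"
    using assms(3) unfolding rel_gens_def by (intro CollectI exI[of _ F] exI[of _ H]) auto
qed

end

section \<open>Monomial bases by induction over up-sets\<close>

lemma sum_union_shifts:
  fixes N M :: "('v \<Rightarrow>\<^sub>0 nat) set"
  assumes "finite N" "finite M" and N: "\<And>m. m \<in> N \<Longrightarrow> v \<notin> keys m" and M: "\<And>m. m \<in> M \<Longrightarrow> v \<notin> keys m"
  shows "(\<Sum>m\<in>N \<union> (\<lambda>(a, m). m + single v a) ` ({1..<c} \<times> M). (fps_X :: int fps) ^ mdeg m)
    = (\<Sum>m\<in>N. fps_X ^ mdeg m) + (\<Sum>a\<in>{1..<c}. fps_X ^ a) * (\<Sum>m\<in>M. fps_X ^ mdeg m)"
proof -
  let ?f = "\<lambda>(a, m). m + single v a"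
  \<comment> \<open>The exponent of \<open>v\<close> tells the pieces apart: it is 0 on
    \<open>N\<close> and \<open>a\<close> on the copy of \<open>M\<close> shifted by
    \<open>a\<close>.\<close>
  have lk: "lookup (m + single v a) v = a" if "m \<in> M" for m a
    using M[OF that] by (simp add: lookup_add in_keys_iff)
  have inj: "inj_on ?f ({1..<c} \<times> M)"
  proof (rule inj_onI, clarify)
    fix a m b n assume "m \<in> M" "n \<in> M" "m + single v a = n + single v b"
    moreover from this have "a = b" using lk by metis
    ultimately show "a = b \<and> m = n" by simp
  qed
  have disj: "N \<inter> ?f ` ({1..<c} \<times> M) = {}"
  proof safe
    fix a m assume "m \<in> M" "m + single v a \<in> N" "a \<in> {1..<c}"
    with N[OF this(2)] lk[OF this(1), of a] show "m + single v a \<in> {}" by (simp add: in_keys_iff)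
  qed
  have "(\<Sum>m\<in>?f ` ({1..<c} \<times> M). (fps_X :: int fps) ^ mdeg m)
      = (\<Sum>(a, m)\<in>{1..<c} \<times> M. fps_X ^ a * fps_X ^ mdeg m)"
    by (subst sum.reindex[OF inj]) (auto intro!: sum.cong simp: mdeg_add power_add mult.commute)
  also have "\<dots> = (\<Sum>a\<in>{1..<c}. fps_X ^ a) * (\<Sum>m\<in>M. fps_X ^ mdeg m)"
    by (simp add: sum_product sum.cartesian_product)
  finally show ?thesis using assms(1,2) disj by (subst sum.union_disjoint) auto
qed

context loopless_matroid
begin

text \<open>The difference \<open>z_F - z_H\<close> is a sum of \<open>x_G\<close> with
  \<open>G\<close> above \<open>F\<close> but not above \<open>H\<close>, and each is killed by
  \<open>z_H ^ n\<close> once \<open>n\<close> is at least \<open>rk H - rk F\<close>. So a factor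
  \<open>z_F\<close> may be replaced by \<open>z_H\<close>, and the product becomes
  \<open>z_H ^ (rk H + 1 - s)\<close>, a defining relation.\<close>

lemma z_power_in_flat_ideal:
  assumes P: "upset P" and F: "F \<in> L" "\<And>G. G \<in> P \<Longrightarrow> s \<le> rk (F \<inter> G) + 1" "\<And>G. F \<subset> G \<Longrightarrow> G \<in> L \<Longrightarrow> G \<in> P"
    and s: "s \<le> rk F" and H: "H \<in> P" "F \<subset> H" and FP: "F \<notin> P"
  shows "z P F ^ (rk F + 1 - s) * z P H ^ (rk H - rk F) \<in> flat_ideal P s"
proof -
  let ?V = "Inl ` P :: 'a var set"
  have I: "ideal_in (polys ?V) (flat_ideal P s)" by (rule ideal_genid)
  have HL: "H \<in> L" by (rule upset_flat[OF P H(1)])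
  have fP: "finite P" by (rule upset_finite[OF P])
  have zV: "z P K \<in> polys ?V" for K by (rule z_polys) auto
  have step: "(z P F - z P H) * z P H ^ n \<in> flat_ideal P s" if n: "rk H - rk F \<le> n" for n
  proof -
    have "z P F - z P H = (\<Sum>G\<in>{G \<in> P. F \<subseteq> G} - {G \<in> P. H \<subseteq> G}. xv G)"
      unfolding z_def using H(2) fP by (subst sum_diff) auto
    then have "(z P F - z P H) * z P H ^ n = (\<Sum>G\<in>{G \<in> P. F \<subseteq> G} - {G \<in> P. H \<subseteq> G}. xv G * z P H ^ n)"
      by (simp add: sum_distrib_right)
    also have "\<dots> \<in> flat_ideal P s"
    proof (rule ideal_in_sum[OF I])
      fix G assume "G \<in> {G \<in> P. F \<subseteq> G} - {G \<in> P. H \<subseteq> G}"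
      then have G: "G \<in> P" "F \<subseteq> G" "\<not> H \<subseteq> G" by auto
      have "rk F \<le> rk (G \<inter> H)"
        using G H upset_flat[OF P] flat_Int[of G H] by (intro flat_rk_le) auto
      then have "rk H \<le> n + rk (G \<inter> H)" using n by simp
      then show "xv G * z P H ^ n \<in> flat_ideal P s"
        using G HL by (intro x_times_z_power[OF P I flat_ideal_gens(1,2)]) auto
    qed
    finally show ?thesis .
  qed
  have red: "z P F ^ i * z P H ^ n - z P H ^ (n + i) \<in> flat_ideal P s" if n: "rk H - rk F \<le> n" for i n
  proof (induction i)
    case (Suc i)
    have "z P F * (z P F ^ i * z P H ^ n - z P H ^ (n + i)) + (z P F - z P H) * z P H ^ (n + i) \<in> flat_ideal P s"
      using n by (intro ideal_in_add[OF I] ideal_in_mult[OF I] step Suc zV) auto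
    then show ?case by (simp add: algebra_simps)
  qed (simp add: ideal_in_0[OF I])
  have "rk F \<le> rk H" using H HL by (intro flat_rk_le) auto
  then have "rk H - rk F + (rk F + 1 - s) = rk H + 1 - s" using s by simp
  then have "z P H ^ (rk H - rk F + (rk F + 1 - s)) \<in> flat_ideal P s" using flat_ideal_gens(3)[OF H(1)] by simp
  then show ?thesis using ideal_in_cong[OF I red[of "rk H - rk F" "rk F + 1 - s"]] by simp
qed

lemma flat_gensE:
  assumes "g \<in> flat_gens P s"
  obtains A B where "g = xv A * xv B" "A \<in> P" "B \<in> P" "\<not> A \<subseteq> B" "\<not> B \<subseteq> A"
    | A H where "g = xv A * z P H ^ (rk H - rk A)" "A \<in> P" "H \<in> P" "A \<subset> H"
    | H where "g = z P H ^ (rk H + 1 - s)" "H \<in> P"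
  using assms unfolding flat_gens_def incomp_gens_def rel_gens_def Un_iff mem_Collect_eq
  by (elim disjE exE conjE) blast+

text \<open>The last hypothesis says that meets do not fall below the virtual bottom of rank
  \<open>s - 1\<close>. Meets may lie outside \<open>P\<close>, so it has to be carried through the
  induction.\<close>

lemma flat_ideal_monbasis:
  assumes "upset P" "\<And>F. F \<in> P \<Longrightarrow> s \<le> rk F" "\<And>F G. F \<in> P \<Longrightarrow> G \<in> P \<Longrightarrow> s \<le> rk (F \<inter> G) + 1"
  shows "\<exists>N. finite N \<and> monbasis (Inl ` P) (flat_ideal P s) N \<and>
    (\<Sum>m\<in>N. fps_X ^ mdeg m) = 1 + (\<Sum>G\<in>P. (\<Sum>a\<in>{1..<rk G + 1 - s}. fps_X ^ a) * chow_series E rk G)"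
  using assms
proof (induction "card P" arbitrary: P s rule: less_induct)
  case less
  note P = less.prems(1)
  have fP: "finite P" by (rule upset_finite[OF P])
  show ?case
  proof (cases "P = {}")
    case True
    have "flat_gens {} s = {}" by (simp add: flat_gens_def incomp_gens_def rel_gens_def)
    then show ?thesis using True monbasis_empty by (intro exI[of _ "{0}"]) simp
  next
    case False
    obtain F where F: "F \<in> P" "\<And>G. G \<in> P \<Longrightarrow> \<not> G \<subset> F"
      using finite_has_minimal[OF fP False] by (metis psubsetE subset_antisym)
    have FL: "F \<in> L" by (rule upset_flat[OF P F(1)])
    define P' where "P' = P - {F}"
    define Q where "Q = {G \<in> L. F \<subset> G}"
    have PP': "P = insert F P'" "F \<notin> P'" using F by (auto simp: P'_def)
    have uP': "upset P'"
      unfolding upset_def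
    proof (intro conjI ballI impI)
      show "P' \<subseteq> L" using P by (auto simp: upset_def P'_def)
      fix A B assume AB: "A \<in> P'" "B \<in> L" "A \<subseteq> B"
      then have "B \<in> P" using P by (auto simp: upset_def P'_def)
      moreover have "B \<noteq> F" using AB F(2)[of A] by (auto simp: P'_def)
      ultimately show "B \<in> P'" by (simp add: P'_def)
    qed
    have uQ: "upset Q" unfolding Q_def by (rule upset_above)
    have QP': "Q \<subseteq> P'" using P F(1) by (auto simp: Q_def P'_def upset_def)
    have fP': "finite P'" and fQ: "finite Q" using uP' uQ upset_finite by auto
    have card: "card P' < card P" "card Q < card P"
      using PP' fP' card_mono[OF fP' QP'] by auto
    have "\<exists>N. finite N \<and> monbasis (Inl ` P') (flat_ideal P' s) N \<and>
      (\<Sum>m\<in>N. fps_X ^ mdeg m) = 1 + (\<Sum>G\<in>P'. (\<Sum>a\<in>{1..<rk G + 1 - s}. fps_X ^ a) * chow_series E rk G)"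
      by (rule less.hyps[OF card(1) uP']) (use less.prems in \<open>auto simp: P'_def\<close>)
    then obtain N where N: "finite N" "monbasis (Inl ` P') (flat_ideal P' s) N"
      "(\<Sum>m\<in>N. fps_X ^ mdeg m) = 1 + (\<Sum>G\<in>P'. (\<Sum>a\<in>{1..<rk G + 1 - s}. fps_X ^ a) * chow_series E rk G)"
      by blast
    \<comment> \<open>For this \<open>s\<close> the right-hand side is exactly the recursive
      equation of \<open>chow_series\<close> at \<open>F\<close>.\<close>
    have "\<exists>M. finite M \<and> monbasis (Inl ` Q) (flat_ideal Q (rk F + 1)) M \<and>
      (\<Sum>m\<in>M. fps_X ^ mdeg m) = 1 + (\<Sum>G\<in>Q. (\<Sum>a\<in>{1..<rk G + 1 - (rk F + 1)}. fps_X ^ a) * chow_series E rk G)"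
    proof (rule less.hyps[OF card(2) uQ])
      show "rk F + 1 \<le> rk G" if "G \<in> Q" for G
        using that flat_rk_less[OF FL, of G] by (auto simp: Q_def)
      show "rk F + 1 \<le> rk (G \<inter> H) + 1" if "G \<in> Q" "H \<in> Q" for G H
        using that flat_Int[of G H] by (auto simp: Q_def intro!: flat_rk_le)
    qed
    then obtain M where M: "finite M" "monbasis (Inl ` Q) (flat_ideal Q (rk F + 1)) M"
      "(\<Sum>m\<in>M. fps_X ^ mdeg m) = chow_series E rk F"
      using finite_E by (auto simp: chow_series.simps[of E rk F] Q_def)
    let ?V' = "Inl ` P' :: 'a var set"
    let ?w = "\<lambda>v. Var v - (\<lambda>_. 0 :: 'a mpoly) v"
    \<comment> \<open>\<open>K\<close> presents the Chow ring of \<open>M/F\<close> as a quotient of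
      the ring in all variables of \<open>P'\<close>: those belonging to flats not above
      \<open>F\<close> are set to 0, written \<open>Var v - 0\<close> to fit
      \<open>monbasis_linear_adjoin\<close>.\<close>
    let ?GK = "flat_gens Q (rk F + 1) \<union> ?w ` (Inl ` (P' - Q))"
    define K where "K = genid (polys ?V') ?GK"
    have V'Q: "Inl ` Q \<union> Inl ` (P' - Q) = ?V'" using QP' by auto
    have MK: "monbasis ?V' K M"
      using monbasis_linear_adjoin[OF M(2), of "Inl ` (P' - Q)" "\<lambda>_. 0"] fP' flat_gens_polys V'Q
      by (auto simp: K_def)
    have idI: "ideal_in (polys ?V') (flat_ideal P' s)" and idK: "ideal_in (polys ?V') K"
      unfolding K_def by (rule ideal_genid)+
    have GQ: "flat_gens Q (rk F + 1) \<subseteq> polys ?V'"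
      using flat_gens_polys[of Q "rk F + 1"] polys_mono[of "Inl ` Q" ?V'] QP' by auto
    have KV: "K \<subseteq> polys ?V'"
      unfolding K_def using GQ by (intro genid_subset_polys) (auto intro!: polys_Var)
    have z'V: "z P' H \<in> polys ?V'" for H by (rule z_polys) auto
    have xK: "xv G \<in> K" if "G \<in> P'" "\<not> F \<subset> G" for G
    proof -
      have "xv G \<in> ?GK" using that by (auto simp: xv_def Q_def)
      then show ?thesis unfolding K_def by (rule genid_gen)
    qed
    have gQK: "g \<in> K" if "g \<in> flat_gens Q (rk F + 1)" for g
      unfolding K_def using that by (intro genid_gen) auto
    have sF: "s \<le> rk F" using less.prems(2) F(1) by auto
    have sFG: "s \<le> rk (F \<inter> G) + 1" if "G \<in> P'" for G
      using less.prems(3)[of F G] F(1) that by (auto simp: P'_def)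
    have xzK: "xv A * z P' H ^ (rk H - rk A) \<in> K" if "A \<in> P'" "H \<in> P'" "A \<subset> H" for A H
    proof (cases "F \<subset> A")
      case True
      then have AH: "A \<in> Q" "H \<in> Q" using that upset_flat[OF uP'] by (auto simp: Q_def)
      then have "z P' H = z Q H" using z_upset uP' uQ that by auto
      moreover have "xv A * z Q H ^ (rk H - rk A) \<in> flat_gens Q (rk F + 1)"
        using AH that by (auto simp: flat_gens_def rel_gens_def)
      ultimately show ?thesis using gQK by simp
    next
      case False
      then have "z P' H ^ (rk H - rk A) * xv A \<in> K"
        using xK that by (intro ideal_in_mult[OF idK] polys_power z'V) auto
      then show ?thesis by (simp add: mult.commute)
    qed
    have incK: "incomp_gens P' \<subseteq> K"
    proof
      fix g assume "g \<in> incomp_gens P'"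
      then obtain A B where g: "g = xv A * xv B" "A \<in> P'" "B \<in> P'" "\<not> A \<subseteq> B" "\<not> B \<subseteq> A"
        by (auto simp: incomp_gens_def)
      consider "A \<in> Q" "B \<in> Q" | "\<not> F \<subset> B" | "\<not> F \<subset> A"
        using g upset_flat[OF uP'] by (auto simp: Q_def)
      then show "g \<in> K"
      proof cases
        case 1
        then show ?thesis using g by (intro gQK) (auto simp: flat_gens_def incomp_gens_def)
      next
        case 2
        then show ?thesis unfolding g(1)
          using g xK by (intro ideal_in_mult[OF idK] x_polys[of _ P']) auto
      next
        case 3
        then show ?thesis unfolding g(1) mult.commute[of "xv A"]
          using g xK by (intro ideal_in_mult[OF idK] x_polys[of _ P']) auto
      qed
    qed
    \<comment> \<open>Modulo \<open>K\<close> only flats above \<open>F\<close> remain, so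
      \<open>z_H\<close> becomes \<open>z\<close> of the join with \<open>F\<close>. Its exponent
      there, \<open>rk ?J - rk F\<close>, is at most \<open>rk H - rk (F \<inter> H)\<close>, hence
      at most \<open>rk H + 1 - s\<close>.\<close>
    have zK: "z P' H ^ (rk H + 1 - s) \<in> K" if H: "H \<in> P'" for H
    proof -
      have HL: "H \<in> L" by (rule upset_flat[OF uP' H])
      note J = join_flat[OF FL HL]
      let ?J = "cl (F \<union> H)"
      have "\<not> H \<subseteq> F" using F(2)[of H] H by (auto simp: P'_def)
      then have JQ: "?J \<in> Q" using J(1,2,3) by (auto simp: Q_def)
      have sub: "{G \<in> P'. ?J \<subseteq> G} \<subseteq> {G \<in> P'. H \<subseteq> G}" using J(3) by auto
      have "z P' H - z P' ?J = (\<Sum>G\<in>{G \<in> P'. H \<subseteq> G} - {G \<in> P'. ?J \<subseteq> G}. xv G)"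
        unfolding z_def using sub fP' by (subst sum_diff) auto
      also have "\<dots> \<in> K"
      proof (intro ideal_in_sum[OF idK] xK)
        fix G assume G: "G \<in> {G \<in> P'. H \<subseteq> G} - {G \<in> P'. ?J \<subseteq> G}"
        then show "\<not> F \<subset> G" using J(5)[of G] upset_flat[OF uP', of G] by auto
      qed auto
      finally have red: "1 * (z P' H - z P' ?J) \<in> K" by simp
      have "z Q ?J ^ (rk ?J + 1 - (rk F + 1)) \<in> flat_gens Q (rk F + 1)"
        using JQ unfolding flat_gens_def by blast
      then have "1 * z P' ?J ^ (rk ?J - rk F) \<in> K"
        using gQK z_upset[OF uQ JQ] z_upset[OF uP', of ?J] JQ QP' by auto
      moreover have "rk ?J - rk F \<le> rk H + 1 - s" using J(4) sFG[OF H] by simp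
      ultimately have "1 * z P' ?J ^ (rk H + 1 - s) \<in> K"
        using ideal_power_mono[OF idK z'V] by blast
      then show ?thesis using ideal_power_cong[OF idK z'V z'V red] by simp
    qed
    have IK: "flat_ideal P' s \<subseteq> K"
    proof
      fix f assume f: "f \<in> flat_ideal P' s"
      have "rel_gens P' \<subseteq> K" using xzK by (auto simp: rel_gens_def)
      then have "flat_gens P' s \<subseteq> K" using incK zK unfolding flat_gens_def by blast
      with f genid_minimal[OF _ idK] show "f \<in> K" by blast
    qed
    define c where "c = rk F + 1 - s"
    have c: "c \<ge> 1" using sF by (simp add: c_def)
    \<comment> \<open>Here \<open>T\<close> stands for \<open>x_F\<close>; since
      \<open>z P F = x_F + z P' F\<close>, the equation \<open>p(T) = 0\<close> is the relation
      \<open>z P F ^ c = 0\<close> of the new flat, and its constant coefficient is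
      \<open>z P' F ^ c\<close>.\<close>
    define p where "p = [:z P' F, 1:] ^ c"
    have p: "p \<in> pcoeffs ?V'" "degree p = c" "coeff p c = 1" "coeff p 0 = z P' F ^ c"
      "poly p (Var (Inl F)) = z P F ^ c"
    proof -
      show "p \<in> pcoeffs ?V'" unfolding p_def using z'V by (intro pcoeffs_power) simp
      show "degree p = c" unfolding p_def by (rule degree_linear_power)
      show "coeff p c = 1" unfolding p_def by (rule coeff_linear_power)
      show "coeff p 0 = z P' F ^ c" by (simp add: p_def coeff_0_power)
      have "z P F = xv F + z P' F"
      proof -
        have "{G \<in> P. F \<subseteq> G} = insert F {G \<in> P'. F \<subseteq> G}" using PP' by auto
        then show ?thesis using fP' PP'(2) by (simp add: z_def)
      qed
      then show "poly p (Var (Inl F)) = z P F ^ c" by (simp add: p_def xv_def add.commute)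
    qed
    \<comment> \<open>The four kinds of generators of \<open>K\<close>: the first two are already
      relations of \<open>P'\<close>, powers of \<open>z_H\<close> are handled by
      \<open>z_power_in_flat_ideal\<close>, and variables not above \<open>F\<close> by
      \<open>x_times_z_power\<close> with \<open>F\<close> in the role of \<open>H\<close>.\<close>
    have pK: "z P' F ^ c * k \<in> flat_ideal P' s" if k: "k \<in> K" for k
    proof -
      have id: "ideal_in (polys ?V') {k. z P' F ^ c * k \<in> flat_ideal P' s}"
        by (rule ideal_colon[OF idI]) simp
      have inI: "z P' F ^ c * g \<in> flat_ideal P' s" if "g \<in> flat_ideal P' s" for g
        using that z'V by (intro ideal_in_mult[OF idI] polys_power)
      have "?GK \<subseteq> {k. z P' F ^ c * k \<in> flat_ideal P' s}"
      proof
        fix g assume "g \<in> ?GK"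
        then consider "g \<in> incomp_gens Q" | "g \<in> rel_gens Q"
          | H where "H \<in> Q" "g = z Q H ^ (rk H - rk F)" | G where "G \<in> P'" "\<not> F \<subset> G" "g = xv G"
          using upset_flat[OF uP'] by (auto simp: flat_gens_def xv_def Q_def)
        then have "z P' F ^ c * g \<in> flat_ideal P' s"
        proof cases
          case 1
          then show ?thesis using incomp_gens_mono[OF QP'] flat_ideal_gens(1) by (intro inI) blast
        next
          case 2
          then show ?thesis using rel_gens_mono[OF uQ uP' QP'] flat_ideal_gens(2) by (intro inI) blast
        next
          case 3
          then have H: "H \<in> P'" "F \<subset> H" "z Q H = z P' H"
            using QP' z_upset[OF uQ] z_upset[OF uP'] by (auto simp: Q_def)
          then show ?thesis
            using z_power_in_flat_ideal[OF uP' FL, of s H] sFG sF QP' PP'(2) 3 by (auto simp: c_def Q_def)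
        next
          case 4
          have "\<not> F \<subseteq> G" using 4 PP'(2) by auto
          moreover have "rk F \<le> c + rk (G \<inter> F)"
            using sFG[OF 4(1)] by (simp add: c_def Int_commute)
          ultimately have "xv G * z P' F ^ c \<in> flat_ideal P' s"
            using 4 FL by (intro x_times_z_power[OF uP' idI flat_ideal_gens(1,2)]) auto
          then show ?thesis using 4 by (simp add: mult.commute)
        qed
        then show "g \<in> {k. z P' F ^ c * k \<in> flat_ideal P' s}" by simp
      qed
      with k show ?thesis unfolding K_def using genid_minimal[OF _ id] by blast
    qed
    let ?V = "Inl ` P :: 'a var set"
    have VV': "insert (Inl F) ?V' = ?V" using PP' by auto
    have idP: "ideal_in (polys ?V) (flat_ideal P s)" by (rule ideal_genid)
    have z_eq: "z P H = z P' H" if "H \<in> P'" for H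
      using z_upset[OF P] z_upset[OF uP' that] that PP' by auto
    have I_sub: "flat_ideal P' s \<subseteq> flat_ideal P s"
    proof (rule genid_mono)
      show "Inl ` P' \<subseteq> ?V" using PP' by auto
      have "P' \<subseteq> P" using PP' by auto
      moreover have "z P' H ^ (rk H + 1 - s) \<in> flat_ideal P s" if "H \<in> P'" for H
        using flat_ideal_gens(3)[of H P s] z_eq[OF that] that PP' by simp
      ultimately show "flat_gens P' s \<subseteq> flat_ideal P s"
        using incomp_gens_mono[of P' P] rel_gens_mono[OF uP' P] flat_ideal_gens(1,2)[of P s]
        unfolding flat_gens_def by blast
    qed
    \<comment> \<open>Multiplied by \<open>x_F\<close>, the power of \<open>z_H\<close> in
      \<open>K\<close> becomes the relation for the pair \<open>F\<close>, \<open>H\<close>, and a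
      killed variable becomes an incomparability relation, by minimality of
      \<open>F\<close>.\<close>
    have TK: "xv F * k \<in> flat_ideal P s" if k: "k \<in> K" for k
    proof -
      have id: "ideal_in (polys ?V') {k. xv F * k \<in> flat_ideal P s}"
        using PP' by (intro ideal_colon[OF idP]) auto
      have FV: "xv F \<in> polys ?V" using F(1) by (intro x_polys[of _ P]) auto
      have inI: "xv F * g \<in> flat_ideal P s" if "g \<in> flat_ideal P s" for g
        using that FV by (intro ideal_in_mult[OF idP])
      have "?GK \<subseteq> {k. xv F * k \<in> flat_ideal P s}"
      proof
        fix g assume "g \<in> ?GK"
        then consider "g \<in> incomp_gens Q" | "g \<in> rel_gens Q"
          | H where "H \<in> Q" "g = z Q H ^ (rk H - rk F)" | G where "G \<in> P'" "\<not> F \<subset> G" "g = xv G"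
          using upset_flat[OF uP'] by (auto simp: flat_gens_def xv_def Q_def)
        then have "xv F * g \<in> flat_ideal P s"
        proof cases
          case 1
          have "Q \<subseteq> P" using QP' PP' by auto
          with 1 show ?thesis using incomp_gens_mono[of Q P] flat_ideal_gens(1) by (intro inI) blast
        next
          case 2
          have "Q \<subseteq> P" using QP' PP' by auto
          with 2 show ?thesis using rel_gens_mono[OF uQ P] flat_ideal_gens(2) by (intro inI) blast
        next
          case 3
          then have H: "H \<in> P" "F \<subset> H" "z Q H = z P H"
            using QP' PP' z_upset[OF uQ] z_upset[OF P] by (auto simp: Q_def)
          then have "xv F * g \<in> rel_gens P" using F(1) 3 unfolding rel_gens_def by auto
          then show ?thesis using flat_ideal_gens(2) by blast
        next
          case 4
          then have "\<not> F \<subseteq> G" "\<not> G \<subseteq> F" "G \<in> P" using PP' F(2)[of G] by auto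
          then have "xv F * g \<in> incomp_gens P" using F(1) 4 unfolding incomp_gens_def by blast
          then show ?thesis using flat_ideal_gens(1) by blast
        qed
        then show "g \<in> {k. xv F * k \<in> flat_ideal P s}" by simp
      qed
      with k show ?thesis unfolding K_def using genid_minimal[OF _ id] by blast
    qed
    \<comment> \<open>Conversely, a relation of \<open>P\<close> that does not come from
      \<open>P'\<close> either has the factor \<open>x_F\<close> or is the power of
      \<open>z P F\<close>.\<close>
    have gens_cases: "g \<in> flat_ideal P' s \<or> (\<exists>k\<in>K. g = Var (Inl F) * k) \<or> g = poly p (Var (Inl F))"
      if g: "g \<in> flat_gens P s" for g
    proof -
      from g consider A B where "g = xv A * xv B" "A \<in> P" "B \<in> P" "\<not> A \<subseteq> B" "\<not> B \<subseteq> A"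
        | A H where "g = xv A * z P H ^ (rk H - rk A)" "A \<in> P" "H \<in> P" "A \<subset> H"
        | H where "g = z P H ^ (rk H + 1 - s)" "H \<in> P"
        by (rule flat_gensE)
      then show ?thesis
      proof cases
        case 1
        consider "A = F" | "B = F" | "A \<in> P'" "B \<in> P'" using 1 PP' by auto
        then show ?thesis
        proof cases
          case a: 1
          then have "xv B \<in> K" using 1 PP' by (intro xK) auto
          then show ?thesis using 1 a by (auto simp: xv_def)
        next
          case b: 2
          then have "xv A \<in> K" using 1 PP' by (intro xK) auto
          then show ?thesis using 1 b by (auto simp: xv_def mult.commute)
        next
          case 3
          then have "g \<in> incomp_gens P'" using 1 by (auto simp: incomp_gens_def)
          then show ?thesis using flat_ideal_gens(1) by blast
        qed
      next
        case 2
        then have H: "H \<in> P'" using F(2)[of A] by (auto simp: P'_def)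
        show ?thesis
        proof (cases "A = F")
          case True
          have HQ: "H \<in> Q" using 2 True upset_flat[OF P] by (auto simp: Q_def)
          then have "z Q H ^ (rk H + 1 - (rk F + 1)) \<in> flat_gens Q (rk F + 1)" unfolding flat_gens_def by blast
          then have "z P H ^ (rk H - rk A) \<in> K"
            using gQK z_upset[OF uQ HQ] z_upset[OF P 2(3)] True by auto
          then show ?thesis using 2 True by (auto simp: xv_def)
        next
          case False
          then have "g \<in> rel_gens P'" using 2 H PP' z_eq[OF H] unfolding rel_gens_def by auto
          then show ?thesis using flat_ideal_gens(2) by blast
        qed
      next
        case 3
        show ?thesis
        proof (cases "H = F")
          case True
          then show ?thesis using 3 p(5) by (simp add: c_def)
        next
          case False
          then have "H \<in> P'" using 3 PP' by auto
          then show ?thesis using 3 z_eq flat_ideal_gens(3) by auto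
        qed
      qed
    qed
    let ?N = "N \<union> (\<lambda>(a, m). m + single (Inl F) a) ` ({1..<c} \<times> M)"
    have nF: "Inl F \<notin> ?V'" using PP' by auto
    have "monbasis (insert (Inl F) ?V') (genid (polys (insert (Inl F) ?V')) (flat_gens P s)) ?N"
    proof (rule monbasis_adjoin[OF nF idI idK IK KV p(1,2,3) c _ N(2) MK])
      show "coeff p 0 * k \<in> flat_ideal P' s" if "k \<in> K" for k using pK[OF that] p(4) by simp
      show "flat_ideal P' s \<subseteq> genid (polys (insert (Inl F) ?V')) (flat_gens P s)" using I_sub VV' by simp
      show "poly p (Var (Inl F)) \<in> genid (polys (insert (Inl F) ?V')) (flat_gens P s)"
        using flat_ideal_gens(3)[OF F(1), of s] p(5) VV' by (simp add: c_def)
      show "Var (Inl F) * k \<in> genid (polys (insert (Inl F) ?V')) (flat_gens P s)" if "k \<in> K" for k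
        using TK[OF that] VV' by (simp add: xv_def)
    qed (rule gens_cases)
    then have "monbasis ?V (flat_ideal P s) ?N" using VV' by simp
    moreover have "finite ?N" using N(1) M(1) by simp
    moreover have "(\<Sum>m\<in>?N. fps_X ^ mdeg m)
      = 1 + (\<Sum>G\<in>P. (\<Sum>a\<in>{1..<rk G + 1 - s}. fps_X ^ a) * chow_series E rk G)"
    proof -
      have "(\<Sum>m\<in>?N. (fps_X :: int fps) ^ mdeg m)
        = (\<Sum>m\<in>N. fps_X ^ mdeg m) + (\<Sum>a\<in>{1..<c}. fps_X ^ a) * (\<Sum>m\<in>M. fps_X ^ mdeg m)"
        using monbasis_vars[OF N(2)] monbasis_vars[OF MK] nF
        by (intro sum_union_shifts N(1) M(1)) blast+
      then show ?thesis unfolding N(3) M(3) using PP' fP' by (simp add: c_def)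
    qed
    ultimately show ?thesis by blast
  qed
qed

end

section \<open>Dimensions of graded pieces\<close>

lemma (in vector_space) span_imageE:
  assumes "finite N" "t \<in> span (f ` N)"
  obtains c where "t = (\<Sum>m\<in>N. scale (c m) (f m))"
proof -
  have "\<exists>c. t = (\<Sum>m\<in>N. scale (c m) (f m))"
    using assms
  proof (induction N arbitrary: t)
    case (insert a N)
    from insert.prems obtain k where "t - scale k (f a) \<in> span (f ` N)"
      by (auto simp: span_insert)
    then obtain c where c: "t - scale k (f a) = (\<Sum>m\<in>N. scale (c m) (f m))"
      using insert.IH by blast
    have "(\<Sum>m\<in>N. scale ((c(a := k)) m) (f m)) = (\<Sum>m\<in>N. scale (c m) (f m))"
      using insert.hyps by (intro sum.cong) auto
    then have "t = (\<Sum>m\<in>insert a N. scale ((c(a := k)) m) (f m))"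
      using insert.hyps c[symmetric] by simp
    then show ?case by blast
  qed simp
  with that show thesis by blast
qed

text \<open>\<open>indep\<close> and \<open>gen\<close> say that the classes of the
  \<open>f m\<close> form a basis of \<open>U/W\<close>; a basis of \<open>W\<close> together with
  these vectors is then a basis of \<open>U\<close>. Coefficients are indexed by \<open>N\<close>,
  so injectivity of \<open>f\<close> also comes out of \<open>indep\<close>.\<close>

lemma (in vector_space) dim_eq_dim_plus_card:
  assumes WU: "subspace W" "W \<subseteq> U" and S: "finite S" "U \<subseteq> span S"
    and N: "finite N" "f ` N \<subseteq> U"
    and indep: "\<And>c. (\<Sum>m\<in>N. scale (c m) (f m)) \<in> W \<Longrightarrow> \<forall>m\<in>N. c m = 0"
    and gen: "\<And>u. u \<in> U \<Longrightarrow> \<exists>c. u - (\<Sum>m\<in>N. scale (c m) (f m)) \<in> W"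
  shows "dim U = dim W + card N"
proof -
  obtain B where B: "B \<subseteq> W" "independent B" "W \<subseteq> span B" "card B = dim W"
    using basis_exists by blast
  have fB: "finite B" using independent_span_bound[OF S(1) B(2)] B(1) WU(2) S(2) by auto
  have BW: "span B \<subseteq> W" using span_minimal[OF B(1) WU(1)] .
  have "independent (B \<union> f ` N') \<and> card (B \<union> f ` N') = card B + card N'" if "finite N'" "N' \<subseteq> N" for N'
    using that
  proof (induction N')
    case (insert a N')
    have nsp: "f a \<notin> span (B \<union> f ` N')"
    proof
      assume "f a \<in> span (B \<union> f ` N')"
      then obtain b t where bt: "f a = b + t" "b \<in> span B" "t \<in> span (f ` N')"
        by (auto simp: span_Un)
      obtain c where c: "t = (\<Sum>m\<in>N'. scale (c m) (f m))"
        using span_imageE[OF insert.hyps(1) bt(3)] by blast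
      \<comment> \<open>Moving \<open>t\<close> to the other side gives a combination over
        \<open>N\<close> with value \<open>b\<close> in \<open>W\<close> and coefficient 1 at
        \<open>a\<close>, contrary to \<open>indep\<close>.\<close>
      define d where "d = (\<lambda>m. if m = a then 1 else if m \<in> N' then - c m else 0)"
      have "(\<Sum>m\<in>N. scale (d m) (f m)) = (\<Sum>m\<in>insert a N'. scale (d m) (f m))"
        using insert.prems N(1) by (intro sum.mono_neutral_right) (auto simp: d_def)
      also have "\<dots> = f a + (\<Sum>m\<in>N'. scale (d m) (f m))" using insert.hyps by (simp add: d_def)
      also have "(\<Sum>m\<in>N'. scale (d m) (f m)) = - t"
        unfolding c sum_negf[symmetric] using insert.hyps by (intro sum.cong) (auto simp: d_def)
      also have "f a + - t = b" using bt(1) by simp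
      finally have "d a = 0" using indep[of d] bt(2) BW insert.prems by auto
      then show False by (simp add: d_def)
    qed
    then have nin: "f a \<notin> B \<union> f ` N'" using span_base[of "f a" "B \<union> f ` N'"] by auto
    have IH: "independent (B \<union> f ` N')" "card (B \<union> f ` N') = card B + card N'"
      using insert by auto
    have eq: "B \<union> f ` insert a N' = insert (f a) (B \<union> f ` N')" by auto
    have "finite (B \<union> f ` N')" using fB insert.hyps by simp
    then show ?case
      unfolding eq using IH nsp nin insert.hyps by (simp add: independent_insert)
  qed (simp add: B)
  then have BN: "independent (B \<union> f ` N)" "card (B \<union> f ` N) = dim W + card N"
    using N(1) B(4) by auto
  have "U \<subseteq> span (B \<union> f ` N)"
  proof
    fix u assume "u \<in> U"
    then obtain c where c: "u - (\<Sum>m\<in>N. scale (c m) (f m)) \<in> W" using gen by blast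
    have "u - (\<Sum>m\<in>N. scale (c m) (f m)) \<in> span (B \<union> f ` N)"
      using c B(3) span_mono[of B "B \<union> f ` N"] by auto
    moreover have "(\<Sum>m\<in>N. scale (c m) (f m)) \<in> span (B \<union> f ` N)"
      by (intro span_sum span_scale span_base) auto
    ultimately have "u - (\<Sum>m\<in>N. scale (c m) (f m)) + (\<Sum>m\<in>N. scale (c m) (f m)) \<in> span (B \<union> f ` N)"
      by (rule span_add)
    then show "u \<in> span (B \<union> f ` N)" by simp
  qed
  moreover have "B \<union> f ` N \<subseteq> U" using B(1) WU(2) N(2) by auto
  ultimately have "dim U = card (B \<union> f ` N)" using BN(1) by (intro dim_unique) auto
  with BN(2) show ?thesis by simp
qed

section \<open>Rational scaling and homogeneous components\<close>

lemma pscale_conv_mult: "pscale c p = single 0 c * p"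
  unfolding pscale_def by (rule mult_map_scale_conv_mult)

interpretation pscale: vector_space pscale
  by unfold_locales (simp_all add: pscale_conv_mult distrib_left distrib_right single_add mult_single flip: mult.assoc)

lemma pscale_single: "pscale c (single m d) = single m (c * d)"
  by (simp add: pscale_conv_mult mult_single)

lemma single_0_polys: "single 0 c \<in> polys V"
  by (simp add: polys_single)

definition homogeneous :: "nat \<Rightarrow> (('v \<Rightarrow>\<^sub>0 nat) \<Rightarrow>\<^sub>0 'k::zero) \<Rightarrow> bool" where
  "homogeneous d p \<longleftrightarrow> (\<forall>m\<in>keys p. mdeg m = d)"

definition hpart :: "nat \<Rightarrow> (('v \<Rightarrow>\<^sub>0 nat) \<Rightarrow>\<^sub>0 'k::zero) \<Rightarrow> (('v \<Rightarrow>\<^sub>0 nat) \<Rightarrow>\<^sub>0 'k)" where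
  "hpart d p = Poly_Mapping.mapp (\<lambda>m c. c when mdeg m = d) p"

lemma lookup_hpart: "lookup (hpart d p) m = (lookup p m when mdeg m = d)"
  by (simp add: hpart_def lookup_mapp when_def in_keys_iff)

lemma keys_hpart: "keys (hpart d p) = {m \<in> keys p. mdeg m = d}"
  by (auto simp: in_keys_iff lookup_hpart when_def split: if_splits)

lemma hpart_0 [simp]: "hpart d 0 = 0"
  by (rule poly_mapping_eqI) (simp add: lookup_hpart)

lemma hpart_add: "hpart d (p + q) = hpart d p + hpart d (q :: ('v \<Rightarrow>\<^sub>0 nat) \<Rightarrow>\<^sub>0 'k::comm_ring_1)"
  by (rule poly_mapping_eqI) (simp add: lookup_hpart lookup_add when_def)

lemma hpart_diff: "hpart d (p - q) = hpart d p - hpart d (q :: ('v \<Rightarrow>\<^sub>0 nat) \<Rightarrow>\<^sub>0 'k::comm_ring_1)"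
  by (rule poly_mapping_eqI) (simp add: lookup_hpart lookup_minus when_def)

lemma hpart_sum: "hpart d (sum f A) = (\<Sum>a\<in>A. hpart d (f a :: ('v \<Rightarrow>\<^sub>0 nat) \<Rightarrow>\<^sub>0 'k::comm_ring_1))"
  by (induction A rule: infinite_finite_induct) (auto simp: hpart_add)

lemma hpart_homogeneous: "homogeneous d p \<Longrightarrow> hpart e p = (if e = d then p else 0)"
  by (rule poly_mapping_eqI) (auto simp: lookup_hpart homogeneous_def when_def in_keys_iff)

lemma homogeneous_hpart: "homogeneous d (hpart d p)"
  by (simp add: homogeneous_def keys_hpart)

lemma homogeneous_mult: "homogeneous d p \<Longrightarrow> homogeneous e q \<Longrightarrow> homogeneous (d + e) (p * q)"
  unfolding homogeneous_def using keys_mult[of p q] by (fastforce simp: mdeg_add)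

lemma homogeneous_sum:
  assumes "\<And>a. a \<in> A \<Longrightarrow> homogeneous d (f a)"
  shows "homogeneous d (sum f A)"
  unfolding homogeneous_def
proof
  fix m assume "m \<in> keys (sum f A)"
  then obtain a where "a \<in> A" "m \<in> keys (f a)" using keys_sum[of f A] by blast
  then show "mdeg m = d" using assms by (simp add: homogeneous_def)
qed

lemma homogeneous_diff: "homogeneous d p \<Longrightarrow> homogeneous d q \<Longrightarrow> homogeneous d (p - (q :: ('v \<Rightarrow>\<^sub>0 nat) \<Rightarrow>\<^sub>0 'k::comm_ring_1))"
  unfolding homogeneous_def by (auto simp: in_keys_iff lookup_minus)

lemma homogeneous_Var: "homogeneous 1 (Var v)"
  by (simp add: homogeneous_def Var_def)

lemma homogeneous_single: "homogeneous (mdeg m) (single m c)"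
  by (simp add: homogeneous_def)

lemma hpart_polys: "p \<in> polys V \<Longrightarrow> hpart d p \<in> polys V"
  by (simp add: polys_def keys_hpart)

text \<open>Split the coefficient \<open>a\<close> into monomials: each monomial multiple of a
  homogeneous generator is homogeneous, so \<open>hpart\<close> either keeps it or removes
  it.\<close>

lemma hpart_genid:
  fixes G :: "(('v \<Rightarrow>\<^sub>0 nat) \<Rightarrow>\<^sub>0 'k::comm_ring_1) set"
  assumes G: "\<And>g. g \<in> G \<Longrightarrow> \<exists>d. homogeneous d g" and f: "f \<in> genid (polys V) G"
  shows "hpart j f \<in> genid (polys V) G"
  using f
proof (induction rule: genid.induct)
  case (step a g f)
  obtain d where d: "homogeneous d g" using G step by blast
  have "hpart j (a * g) = (\<Sum>m\<in>keys a. hpart j (single m (lookup a m) * g))"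
    by (subst poly_mapping_sum_singles[of a, symmetric]) (simp add: sum_distrib_right hpart_sum)
  also have "\<dots> \<in> genid (polys V) G"
  proof (rule ideal_in_sum[OF ideal_genid])
    fix m assume m: "m \<in> keys a"
    have "homogeneous (mdeg m + d) (single m (lookup a m) * g)"
      by (intro homogeneous_mult homogeneous_single d)
    moreover have "single m (lookup a m) \<in> polys V"
      using m step by (intro polys_single) (auto simp: polys_def)
    then have "single m (lookup a m) * g \<in> genid (polys V) G"
      using genid_gen[OF \<open>g \<in> G\<close>] by (intro ideal_in_mult[OF ideal_genid])
    ultimately show "hpart j (single m (lookup a m) * g) \<in> genid (polys V) G"
      by (auto simp: hpart_homogeneous genid.zero)
  qed
  finally show ?case using step by (simp add: hpart_add ideal_in_add[OF ideal_genid])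
qed (simp add: genid.zero)

lemma finite_monomials:
  assumes "finite V"
  shows "finite {m :: 'v \<Rightarrow>\<^sub>0 nat. keys m \<subseteq> V \<and> mdeg m = j}"
proof (rule finite_imageD)
  have "lookup ` {m. keys m \<subseteq> V \<and> mdeg m = j}
      \<subseteq> {f. \<forall>v. (v \<in> V \<longrightarrow> f v \<in> {..j}) \<and> (v \<notin> V \<longrightarrow> f v = 0)}"
  proof clarsimp
    fix m :: "'v \<Rightarrow>\<^sub>0 nat" and v
    assume m: "keys m \<subseteq> V" "j = mdeg m"
    have "lookup m v \<le> (\<Sum>u\<in>V. lookup m u)" if "v \<in> V"
      using that assms by (intro member_le_sum) auto
    then show "(v \<in> V \<longrightarrow> lookup m v \<le> mdeg m) \<and> (v \<notin> V \<longrightarrow> lookup m v = 0)"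
      using m mdeg_superset[OF assms m(1)] by (auto simp: in_keys_iff)
  qed
  then show "finite (lookup ` {m. keys m \<subseteq> V \<and> mdeg m = j})"
    using finite_set_of_finite_funs[OF assms, of "{..j}" 0] finite_subset by blast
  show "inj_on lookup {m :: 'v \<Rightarrow>\<^sub>0 nat. keys m \<subseteq> V \<and> mdeg m = j}"
    by (simp add: inj_on_def lookup_inject)
qed

section \<open>Comparing the two presentations of the augmented Chow ring\<close>

lemma chow_polys_eq: "chow_polys E rk = polys (chow_vars E rk)"
  by (simp add: chow_polys_def polys_def)

lemma chow_ideal_eq: "chow_ideal E rk = genid (polys (chow_vars E rk)) (chow_gens E rk)"
  (is "_ = genid ?S ?G")
proof
  show "chow_ideal E rk \<subseteq> genid ?S ?G"
  proof
    fix f assume "f \<in> chow_ideal E rk"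
    then obtain G a where "f = (\<Sum>g\<in>G. a g * g)" "G \<subseteq> ?G" "\<forall>g\<in>G. a g \<in> ?S"
      by (auto simp: chow_ideal_def chow_polys_eq)
    then show "f \<in> genid ?S ?G"
      using genid_gen[of _ ?G "chow_vars E rk"]
      by (auto intro!: ideal_in_sum[OF ideal_genid] ideal_in_mult[OF ideal_genid])
  qed
  show "genid ?S ?G \<subseteq> chow_ideal E rk"
  proof
    fix f assume "f \<in> genid ?S ?G"
    then show "f \<in> chow_ideal E rk"
    proof (induction rule: genid.induct)
      case zero
      show ?case by (auto simp: chow_ideal_def intro!: exI[of _ "{}"])
    next
      case (step a g f)
      then obtain G b where G: "f = (\<Sum>g\<in>G. b g * g)" "finite G" "G \<subseteq> ?G" "\<forall>g\<in>G. b g \<in> ?S"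
        by (auto simp: chow_ideal_def chow_polys_eq)
      \<comment> \<open>If \<open>g\<close> already occurs in \<open>G\<close>, the two coefficients
        must be added, since a sum over a set lists \<open>g\<close> once.\<close>
      define b' where "b' = (\<lambda>h. (if h \<in> G then b h else 0) + (if h = g then a else 0))"
      have "(\<Sum>h\<in>insert g G. b' h * h)
        = (\<Sum>h\<in>insert g G. (if h \<in> G then b h else 0) * h) + (\<Sum>h\<in>insert g G. (if h = g then a else 0) * h)"
        by (simp add: b'_def distrib_right sum.distrib)
      also have "(\<Sum>h\<in>insert g G. (if h \<in> G then b h else 0) * h) = f"
        unfolding G(1) using G(2) by (intro sum.mono_neutral_cong_right) auto
      also have "(\<Sum>h\<in>insert g G. (if h = g then a else 0) * h) = a * g"
        using G(2) by (subst sum.mono_neutral_cong_right[of "insert g G" "{g}" _ "\<lambda>_. a * g"]) auto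
      finally have "a * g + f = (\<Sum>h\<in>insert g G. b' h * h)" by simp
      moreover have "\<forall>h\<in>insert g G. b' h \<in> ?S"
        using G(4) step by (auto simp: b'_def intro!: polys_add)
      ultimately show ?case using G(2,3) step unfolding chow_ideal_def chow_polys_eq
        by (intro CollectI exI[of _ "insert g G"] exI[of _ b']) auto
    qed
  qed
qed

lemma pvar_eq_Var: "pvar v = Var v"
  by (simp add: pvar_def Var_def)

context loopless_matroid
begin

definition yv :: "'a \<Rightarrow> 'a mpoly" where "yv i = Var (Inr i)"

definition ysum :: "'a \<Rightarrow> 'a mpoly" where "ysum i = (\<Sum>F\<in>{F \<in> L - {E}. i \<notin> F}. xv F)"

definition all_vars :: "'a var set" where "all_vars = Inl ` L \<union> Inr ` E"

definition ext_ideal :: "'a mpoly set" where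
  "ext_ideal = genid (polys all_vars) (insert (z L {}) (chow_gens E rk))"

lemma chow_gens_eq:
  "chow_gens E rk = {yv i - ysum i | i. i \<in> E}
     \<union> {xv F * xv G | F G. F \<in> L - {E} \<and> G \<in> L - {E} \<and> \<not> F \<subseteq> G \<and> \<not> G \<subseteq> F}
     \<union> {yv i * xv F | i F. i \<in> E \<and> F \<in> L - {E} \<and> i \<notin> F}"
  by (simp add: chow_gens_def pvar_eq_Var xv_def yv_def ysum_def)

lemma ideal_ext_ideal: "ideal_in (polys all_vars) ext_ideal"
  unfolding ext_ideal_def by (rule ideal_genid)

lemma ext_ideal_gens:
  "z L {} \<in> ext_ideal"
  "i \<in> E \<Longrightarrow> yv i - ysum i \<in> ext_ideal"
  "F \<in> L \<Longrightarrow> i \<in> E \<Longrightarrow> i \<notin> F \<Longrightarrow> yv i * xv F \<in> ext_ideal"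
  unfolding ext_ideal_def by (rule genid_gen; auto simp: chow_gens_eq)+

lemma ext_ideal_incomp: "incomp_gens L \<subseteq> ext_ideal"
proof
  fix g assume "g \<in> incomp_gens L"
  then obtain F G where g: "g = xv F * xv G" "F \<in> L" "G \<in> L" "\<not> F \<subseteq> G" "\<not> G \<subseteq> F"
    by (auto simp: incomp_gens_def)
  then have "F \<noteq> E" "G \<noteq> E" using flat_subset by auto
  then have "g \<in> chow_gens E rk" using g unfolding chow_gens_eq by blast
  then show "g \<in> ext_ideal" unfolding ext_ideal_def by (intro genid_gen) auto
qed

lemma polys_all: "F \<in> L \<Longrightarrow> xv F \<in> polys all_vars" "z L H \<in> polys all_vars"
  "i \<in> E \<Longrightarrow> yv i \<in> polys all_vars" "ysum i \<in> polys all_vars"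
  by (auto simp: all_vars_def yv_def ysum_def intro!: x_polys[of _ L] z_polys polys_Var polys_sum)

text \<open>In the extended ring this is \<open>- y_i\<close>: the relations \<open>z L {}\<close>
  and \<open>yv i - ysum i\<close> combine with \<open>z_empty_eq\<close>.\<close>

definition zpt :: "'a \<Rightarrow> 'a mpoly" where "zpt i = (\<Sum>G\<in>{G \<in> L. i \<in> G}. xv G)"

lemma z_empty_eq: assumes "i \<in> E" shows "z L {} = zpt i + ysum i"
proof -
  have "{G \<in> L. {} \<subseteq> G} = {G \<in> L. i \<in> G} \<union> {F \<in> L - {E}. i \<notin> F}"
    using assms by auto
  then show ?thesis
    unfolding z_def zpt_def ysum_def
    using finite_L by (simp only:) (rule sum.union_disjoint; auto)
qed

lemma zpt_eq: assumes "i \<in> E" shows "zpt i = z L (cl {i})"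
proof -
  have "{G \<in> L. i \<in> G} = {G \<in> L. cl {i} \<subseteq> G}"
    using assms cl_minimal[of _ "{i}"] subset_cl[of "{i}"] by auto
  then show ?thesis by (simp add: zpt_def z_def)
qed

lemma ext_ideal_zpt:
  assumes "A \<in> L" "i \<in> E" "i \<notin> A"
  shows "xv A * zpt i \<in> ext_ideal"
proof -
  have "xv A * (z L {} + (yv i - ysum i)) - yv i * xv A \<in> ext_ideal"
    using assms
    by (intro ideal_in_diff[OF ideal_ext_ideal] ideal_in_mult[OF ideal_ext_ideal] ideal_in_add[OF ideal_ext_ideal] ext_ideal_gens polys_all) auto
  then show ?thesis by (simp add: z_empty_eq[OF assms(2)] algebra_simps)
qed

text \<open>Pick \<open>i\<close> in \<open>H\<close> outside \<open>A\<close> and write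
  \<open>z_H\<close> as \<open>zpt i\<close> minus the \<open>x_G\<close> with \<open>i\<close> in
  \<open>G\<close> but \<open>H\<close> not below \<open>G\<close>. The first term is killed by
  \<open>x_A\<close>. Each \<open>G\<close> is either incomparable to \<open>A\<close>, or contains
  \<open>A\<close> and has a meet with \<open>H\<close> of larger rank, so that one power of
  \<open>z_H\<close> fewer suffices.\<close>

lemma ext_ideal_power:
  assumes "A \<in> L" "H \<in> L" "\<not> H \<subseteq> A" "rk H \<le> n + rk (A \<inter> H)"
  shows "xv A * z L H ^ n \<in> ext_ideal"
  using assms
proof (induction n arbitrary: A)
  case 0
  have "A \<inter> H \<in> L" "A \<inter> H \<subset> H" using 0 flat_Int by auto
  then show ?case using 0 flat_rk_less[of "A \<inter> H" H] by simp
next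
  case (Suc n)
  obtain i where i: "i \<in> H" "i \<notin> A" using Suc.prems by blast
  have iE: "i \<in> E" using i flat_subset Suc.prems by auto
  have "zpt i - z L H = (\<Sum>G\<in>{G \<in> L. i \<in> G} - {G \<in> L. H \<subseteq> G}. xv G)"
    unfolding zpt_def z_def using i finite_L by (subst sum_diff) auto
  then have zH: "z L H = zpt i - (\<Sum>G\<in>{G \<in> L. i \<in> G} - {G \<in> L. H \<subseteq> G}. xv G)"
    by (simp add: algebra_simps)
  have "xv A * z L H ^ Suc n = z L H ^ n * (xv A * z L H)" by simp
  also have "\<dots> = z L H ^ n * (xv A * zpt i)
      - (\<Sum>G\<in>{G \<in> L. i \<in> G} - {G \<in> L. H \<subseteq> G}. xv A * (xv G * z L H ^ n))"
    by (subst (2) zH) (simp add: right_diff_distrib sum_distrib_left mult_ac)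
  also have "\<dots> \<in> ext_ideal"
  proof (intro ideal_in_diff[OF ideal_ext_ideal] ideal_in_sum[OF ideal_ext_ideal])
    show "z L H ^ n * (xv A * zpt i) \<in> ext_ideal"
      using Suc.prems i iE by (intro ideal_in_mult[OF ideal_ext_ideal] polys_power polys_all ext_ideal_zpt)
    fix G assume "G \<in> {G \<in> L. i \<in> G} - {G \<in> L. H \<subseteq> G}"
    then have G: "G \<in> L" "i \<in> G" "\<not> H \<subseteq> G" by auto
    show "xv A * (xv G * z L H ^ n) \<in> ext_ideal"
    proof (cases "A \<subseteq> G")
      case True
      have "A \<inter> H \<subset> G \<inter> H" using True G i by auto
      then have "rk (A \<inter> H) < rk (G \<inter> H)"
        using G Suc.prems by (intro flat_rk_less flat_Int) auto
      then have "xv G * z L H ^ n \<in> ext_ideal" using Suc.prems G by (intro Suc.IH) auto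
      then show ?thesis by (rule ideal_in_mult[OF ideal_ext_ideal polys_all(1)[OF Suc.prems(1)]])
    next
      case False
      then have "xv A * xv G \<in> incomp_gens L" using Suc.prems G i by (auto simp: incomp_gens_def)
      then have "z L H ^ n * (xv A * xv G) \<in> ext_ideal"
        using ext_ideal_incomp by (intro ideal_in_mult[OF ideal_ext_ideal polys_power[OF polys_all(2)]]) auto
      then show ?thesis by (simp add: mult_ac)
    qed
  qed
  finally show ?case .
qed

text \<open>One factor \<open>z_H\<close> is rewritten as \<open>z L {}\<close> minus the
  \<open>x_G\<close> with \<open>G\<close> not above \<open>H\<close>; the remaining
  \<open>rk H\<close> factors kill every such \<open>x_G\<close>, whatever its meet with
  \<open>H\<close>.\<close>

lemma ext_ideal_power_top:
  assumes H: "H \<in> L"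
  shows "z L H ^ Suc (rk H) \<in> ext_ideal"
proof -
  have "z L {} - z L H = (\<Sum>G\<in>{G \<in> L. {} \<subseteq> G} - {G \<in> L. H \<subseteq> G}. xv G)"
    unfolding z_def using finite_L by (subst sum_diff) auto
  then have zH: "z L H = z L {} - (\<Sum>G\<in>{G \<in> L. {} \<subseteq> G} - {G \<in> L. H \<subseteq> G}. xv G)"
    by (simp add: algebra_simps)
  have "z L H ^ Suc (rk H) = z L H ^ rk H * z L H" by simp
  also have "\<dots> = z L H ^ rk H * z L {}
      - (\<Sum>G\<in>{G \<in> L. {} \<subseteq> G} - {G \<in> L. H \<subseteq> G}. xv G * z L H ^ rk H)"
    by (subst (2) zH) (simp add: right_diff_distrib sum_distrib_left mult_ac)
  also have "\<dots> \<in> ext_ideal"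
    using H by (intro ideal_in_diff[OF ideal_ext_ideal] ideal_in_sum[OF ideal_ext_ideal] ideal_in_mult[OF ideal_ext_ideal]
        polys_power polys_all ext_ideal_gens ext_ideal_power) auto
  finally show ?thesis .
qed

definition lin_form :: "'a var \<Rightarrow> 'a mpoly" where
  "lin_form v = (case v of Inl F \<Rightarrow> 0 | Inr i \<Rightarrow> ysum i)"

text \<open>Here the original presentation becomes that of the up-set of all flats with
  \<open>s = 0\<close>, followed by linear relations that merely name the
  \<open>y_i\<close>.\<close>

lemma ext_ideal_eq:
  "ext_ideal = genid (polys all_vars) (flat_gens L 0 \<union> (\<lambda>v. Var v - lin_form v) ` Inr ` E)" (is "_ = ?J")
proof
  have id: "ideal_in (polys all_vars) ?J" by (rule ideal_genid)
  have "flat_gens L 0 \<subseteq> ext_ideal"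
  proof
    fix g assume "g \<in> flat_gens L 0"
    then show "g \<in> ext_ideal"
    proof (cases rule: flat_gensE)
      case (1 A B)
      then have "g \<in> incomp_gens L" unfolding incomp_gens_def by blast
      then show ?thesis using ext_ideal_incomp by blast
    next
      case (2 A H)
      have "A \<inter> H = A" using 2 by auto
      then have "rk H \<le> (rk H - rk A) + rk (A \<inter> H)" by simp
      then show ?thesis unfolding 2(1) using 2 by (intro ext_ideal_power) auto
    next
      case (3 H)
      then show ?thesis using ext_ideal_power_top[of H] by simp
    qed
  qed
  moreover have "(\<lambda>v. Var v - lin_form v) ` Inr ` E \<subseteq> ext_ideal"
    using ext_ideal_gens(2) by (auto simp: lin_form_def yv_def)
  ultimately show "?J \<subseteq> ext_ideal" using genid_minimal[OF _ ideal_ext_ideal] by blast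
  have gJ: "flat_gens L 0 \<subseteq> ?J" by (auto intro: genid_gen)
  have iJ: "incomp_gens L \<subseteq> ?J" "rel_gens L \<subseteq> ?J" using gJ by (auto simp: flat_gens_def)
  have zJ: "z L {} \<in> ?J"
  proof -
    have "z L {} ^ (rk {} + 1 - 0) \<in> flat_gens L 0" unfolding flat_gens_def using empty_flat by blast
    then show ?thesis using gJ by auto
  qed
  have yJ: "yv i - ysum i \<in> ?J" if "i \<in> E" for i
    using that by (intro genid_gen) (auto simp: lin_form_def yv_def image_image)
  have "g \<in> ?J" if g: "g \<in> chow_gens E rk" for g
  proof -
    from g consider i where "i \<in> E" "g = yv i - ysum i"
      | F G where "g = xv F * xv G" "F \<in> L" "G \<in> L" "\<not> F \<subseteq> G" "\<not> G \<subseteq> F"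
      | i F where "i \<in> E" "F \<in> L" "i \<notin> F" "g = yv i * xv F"
      unfolding chow_gens_eq Un_iff mem_Collect_eq Diff_iff by (elim disjE exE conjE) blast+
    then show ?thesis
    proof cases
      case 1
      then show ?thesis using yJ by simp
    next
      case 2
      then have "g \<in> incomp_gens L" unfolding incomp_gens_def by blast
      then show ?thesis using iJ by blast
    next
      case 3
      \<comment> \<open>Looplessness enters here: the closure of a point has rank 1, so the first
        power of its \<open>z\<close> already suffices. As \<open>zpt i\<close> plays the role of
        \<open>- y_i\<close>, this recovers \<open>y_i x_F = 0\<close>.\<close>
      have z: "xv F * z L (cl {i}) ^ 1 \<in> ?J"
      proof (rule x_times_z_power[OF upset_L id iJ])
        show "rk (cl {i}) \<le> 1 + rk (F \<inter> cl {i})"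
          using loopless 3 by (simp add: rk_cl loopless_def)
        show "\<not> cl {i} \<subseteq> F" using subset_cl[of "{i}"] 3 by auto
      qed (use 3 cl_flat in \<open>auto simp: all_vars_def\<close>)
      have x: "xv F * g \<in> ?J" if "g \<in> ?J" for g
        by (rule ideal_in_mult[OF id polys_all(1)[OF 3(2)] that])
      have "xv F * (yv i - ysum i) + (xv F * z L {} - xv F * zpt i) \<in> ?J"
        using z x[OF zJ] x[OF yJ[OF 3(1)]] unfolding zpt_eq[OF 3(1)]
        by (intro ideal_in_add[OF id] ideal_in_diff[OF id]) simp_all
      then show ?thesis using 3 by (simp add: z_empty_eq[OF 3(1)] algebra_simps)
    qed
  qed
  then have "insert (z L {}) (chow_gens E rk) \<subseteq> ?J" using zJ by blast
  then show "ext_ideal \<subseteq> ?J" unfolding ext_ideal_def using genid_minimal[OF _ id] by blast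
qed

lemma all_vars_insert: "all_vars = insert (Inl E) (chow_vars E rk)" "Inl E \<notin> chow_vars E rk"
  using E_flat by (auto simp: all_vars_def chow_vars_def)

lemma chow_gens_polys: "chow_gens E rk \<subseteq> polys (chow_vars E rk)"
proof -
  have "xv F \<in> polys (chow_vars E rk)" if "F \<in> L - {E}" for F
    using that by (auto simp: xv_def chow_vars_def intro!: polys_Var)
  moreover have "yv i \<in> polys (chow_vars E rk)" if "i \<in> E" for i
    using that by (auto simp: yv_def chow_vars_def intro!: polys_Var)
  ultimately show ?thesis
    by (auto simp: chow_gens_eq ysum_def intro!: polys_mult polys_diff polys_sum)
qed

text \<open>The relation \<open>z L {} = 0\<close> only serves to define the extra variable \<open>x_E\<close>, so adding both
  changes neither the ring nor the dimensions of its graded pieces.\<close>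
lemma ext_ideal_restrict:
  "polys (chow_vars E rk) \<inter> ext_ideal = chow_ideal E rk"
  and ext_ideal_lift: "f \<in> polys all_vars \<Longrightarrow> \<exists>g\<in>polys (chow_vars E rk). f - g \<in> ext_ideal"
proof -
  define w where "w = - (\<Sum>F\<in>L - {E}. xv F)"
  have w: "w \<in> polys (chow_vars E rk)"
    by (auto simp: w_def xv_def chow_vars_def intro!: polys_sum polys_Var)
  have "z L {} = Var (Inl E) - w"
    using sum.remove[OF finite_L E_flat, of xv] by (simp add: z_def w_def xv_def)
  then have J: "ext_ideal = genid (polys (insert (Inl E) (chow_vars E rk))) (insert (Var (Inl E) - w) (chow_gens E rk))"
    unfolding ext_ideal_def all_vars_insert(1) by simp
  have "polys (chow_vars E rk) \<inter> ext_ideal \<subseteq> chow_ideal E rk"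
    unfolding chow_ideal_eq J
    using linear_adjoin_single[OF all_vars_insert(2) chow_gens_polys w] by auto
  moreover have "chow_ideal E rk \<subseteq> ext_ideal"
    unfolding chow_ideal_eq J by (rule genid_mono) (auto intro: genid_gen)
  moreover have "chow_ideal E rk \<subseteq> polys (chow_vars E rk)"
    unfolding chow_ideal_eq by (rule genid_subset_polys[OF chow_gens_polys])
  ultimately show "polys (chow_vars E rk) \<inter> ext_ideal = chow_ideal E rk" by blast
  assume "f \<in> polys all_vars"
  then have "f \<in> polys (insert (Inl E) (chow_vars E rk))" by (simp add: all_vars_insert)
  then obtain g where "g \<in> polys (chow_vars E rk)" "f - g \<in> ext_ideal"
    unfolding J by (rule linear_adjoin_reduce_single[OF w])
  then show "\<exists>g\<in>polys (chow_vars E rk). f - g \<in> ext_ideal" by blast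
qed

lemma ext_ideal_hpart: "f \<in> ext_ideal \<Longrightarrow> hpart j f \<in> ext_ideal"
  unfolding ext_ideal_def
proof (rule hpart_genid)
  have x: "homogeneous 1 (xv F)" for F unfolding xv_def by (rule homogeneous_Var)
  have y: "homogeneous 1 (yv i)" for i unfolding yv_def by (rule homogeneous_Var)
  fix g assume "g \<in> insert (z L {}) (chow_gens E rk)"
  then consider "g = z L {}" | i where "g = yv i - ysum i" | F G where "g = xv F * xv G"
    | i F where "g = yv i * xv F"
    unfolding chow_gens_eq insert_iff Un_iff mem_Collect_eq by (elim disjE exE conjE) blast+
  then show "\<exists>d. homogeneous d g"
  proof cases
    case 1
    have "homogeneous 1 (z L {})" unfolding z_def by (intro homogeneous_sum x)
    then show ?thesis using 1 by blast
  next
    case 2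
    have "homogeneous 1 (yv i - ysum i)"
      unfolding ysum_def by (intro homogeneous_diff homogeneous_sum x y)
    then show ?thesis using 2 by blast
  qed (use homogeneous_mult x y in blast)+
qed

text \<open>The homogeneous part of degree \<open>j\<close> of the ideal has, in the degree
  \<open>j\<close> polynomials, a complement represented by the basis monomials of degree
  \<open>j\<close>.\<close>

lemma chow_dim_eq:
  assumes N: "monbasis all_vars ext_ideal N" and fN: "finite N"
  shows "chow_dim E rk j = card {m \<in> N. mdeg m = j}"
proof -
  let ?V = "chow_vars E rk"
  let ?U = "chow_polys_deg E rk j"
  let ?W = "chow_ideal E rk \<inter> ?U"
  let ?N = "{m \<in> N. mdeg m = j}"
  have U: "p \<in> ?U \<longleftrightarrow> p \<in> polys ?V \<and> homogeneous j p" for p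
    by (auto simp: chow_polys_deg_def chow_polys_eq homogeneous_def)
  have W: "p \<in> ?W \<longleftrightarrow> p \<in> ?U \<and> p \<in> ext_ideal" for p
    using ext_ideal_restrict U[of p] by auto
  have "finite ?V" using finite_L finite_E by (auto simp: chow_vars_def)
  then have fM: "finite {m. keys m \<subseteq> ?V \<and> mdeg m = j}" by (rule finite_monomials)
  have VV: "polys ?V \<subseteq> polys all_vars" by (rule polys_mono) (auto simp: all_vars_insert)
  have subU: "pscale.subspace ?U"
  proof (rule pscale.subspaceI)
    show "0 \<in> ?U" by (simp add: U homogeneous_def)
    show "p + q \<in> ?U" if "p \<in> ?U" "q \<in> ?U" for p q
      using that keys_add[of p q] unfolding U homogeneous_def by (auto intro!: polys_add)
    show "pscale c p \<in> ?U" if "p \<in> ?U" for c p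
      using that homogeneous_mult[OF homogeneous_single[of 0 c], of j p]
      unfolding U by (auto simp: pscale_conv_mult intro!: polys_mult single_0_polys)
  qed
  have subJ: "pscale.subspace ext_ideal"
    using ideal_in_0[OF ideal_ext_ideal] ideal_in_add[OF ideal_ext_ideal] ideal_in_mult[OF ideal_ext_ideal single_0_polys]
    by (intro pscale.subspaceI) (auto simp: pscale_conv_mult)
  have "?W = ?U \<inter> ext_ideal" using W by blast
  then have subW: "pscale.subspace ?W" using pscale.subspace_inter[OF subU subJ] by simp
  have spanU: "?U \<subseteq> pscale.span ((\<lambda>m. single m 1) ` {m. keys m \<subseteq> ?V \<and> mdeg m = j})"
  proof
    fix p assume "p \<in> ?U"
    then have p: "p \<in> polys ?V" "homogeneous j p" using U by auto
    have "p = (\<Sum>m\<in>keys p. pscale (lookup p m) (single m 1))"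
      by (simp add: pscale_single poly_mapping_sum_singles)
    also have "\<dots> \<in> pscale.span ((\<lambda>m. single m 1) ` {m. keys m \<subseteq> ?V \<and> mdeg m = j})"
      using p by (intro pscale.span_sum pscale.span_scale pscale.span_base)
        (auto simp: polys_def homogeneous_def)
    finally show "p \<in> pscale.span ((\<lambda>m. single m 1) ` {m. keys m \<subseteq> ?V \<and> mdeg m = j})" .
  qed
  \<comment> \<open>Monomials in \<open>N\<close> may contain the extra variable \<open>x_E\<close>.
    Each is replaced by a congruent polynomial without it, cut down to degree \<open>j\<close> by
    \<open>hpart\<close>.\<close>
  have "\<forall>m\<in>?N. \<exists>f. f \<in> ?U \<and> f - single m 1 \<in> ext_ideal"
  proof
    fix m assume m: "m \<in> ?N"
    have "single m (1::rat) \<in> polys all_vars"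
      using m monbasis_vars[OF N] by (intro polys_single) auto
    then obtain g where g: "g \<in> polys ?V" "single m 1 - g \<in> ext_ideal" using ext_ideal_lift by blast
    have "hpart j (single m 1 - g) \<in> ext_ideal" by (rule ext_ideal_hpart[OF g(2)])
    moreover have "hpart j (single m (1::rat)) = single m 1"
      using m homogeneous_single[of m "1::rat"] by (simp add: hpart_homogeneous)
    ultimately have "- (single m 1 - hpart j g) \<in> ext_ideal"
      by (intro ideal_in_uminus[OF ideal_ext_ideal]) (simp add: hpart_diff)
    moreover have "hpart j g \<in> ?U" using g(1) by (simp add: U hpart_polys homogeneous_hpart)
    ultimately show "\<exists>f. f \<in> ?U \<and> f - single m 1 \<in> ext_ideal"
      by (intro exI[of _ "hpart j g"]) simp
  qed
  from bchoice[OF this] obtain f where f: "\<And>m. m \<in> ?N \<Longrightarrow> f m \<in> ?U" "\<And>m. m \<in> ?N \<Longrightarrow> f m - single m 1 \<in> ext_ideal"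
    by blast
  \<comment> \<open>Independence and spanning can thus be tested on the monomials themselves instead
    of their representatives.\<close>
  have diff: "(\<Sum>m\<in>?N. pscale (c m) (f m)) - (\<Sum>m\<in>?N. single m (c m)) \<in> ext_ideal" for c
  proof -
    have "(\<Sum>m\<in>?N. pscale (c m) (f m)) - (\<Sum>m\<in>?N. single m (c m))
      = (\<Sum>m\<in>?N. pscale (c m) (f m - single m 1))"
      by (simp add: pscale.scale_right_diff_distrib sum_subtractf pscale_single)
    also have "\<dots> \<in> ext_ideal" using f(2) by (intro pscale.subspace_sum[OF subJ] pscale.subspace_scale[OF subJ]) auto
    finally show ?thesis .
  qed
  have lk: "lookup (\<Sum>m\<in>?N. single m (c m)) k = (if k \<in> ?N then c k else 0)" for c :: "_ \<Rightarrow> rat" and k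
    using fN by (simp add: lookup_sum lookup_single when_def)
  have "pscale.dim ?U = pscale.dim ?W + card ?N"
  proof (rule pscale.dim_eq_dim_plus_card[OF subW _ _ spanU])
    fix c assume "(\<Sum>m\<in>?N. pscale (c m) (f m)) \<in> ?W"
    then have "(\<Sum>m\<in>?N. single m (c m)) \<in> ext_ideal"
      using ideal_in_cong[OF ideal_ext_ideal diff[of c]] W by auto
    moreover have "keys (\<Sum>m\<in>?N. single m (c m)) \<subseteq> N"
      using lk[of c] by (auto simp: in_keys_iff split: if_splits)
    ultimately have 0: "(\<Sum>m\<in>?N. single m (c m)) = 0" using monbasis_indep[OF N] by blast
    show "\<forall>m\<in>?N. c m = 0"
    proof
      fix m assume "m \<in> ?N"
      then show "c m = 0" using lk[of c m] unfolding 0 by simp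
    qed
  next
    fix u assume u: "u \<in> ?U"
    then have "u \<in> polys all_vars" using U VV by blast
    then obtain g where g: "keys g \<subseteq> N" "u - g \<in> ext_ideal" using monbasis_reduce[OF N] by blast
    have "hpart j (u - g) \<in> ext_ideal" by (rule ext_ideal_hpart[OF g(2)])
    moreover have "hpart j u = u" using u U hpart_homogeneous[of j u j] by simp
    ultimately have ug: "u - hpart j g \<in> ext_ideal" by (simp add: hpart_diff)
    define c where "c = lookup (hpart j g)"
    have "(\<Sum>m\<in>?N. single m (c m)) = hpart j g"
    proof (rule poly_mapping_eqI)
      fix k
      show "lookup (\<Sum>m\<in>?N. single m (c m)) k = lookup (hpart j g) k"
        unfolding lk using g(1) by (auto simp: c_def lookup_hpart when_def in_keys_iff)
    qed
    then have "(\<Sum>m\<in>?N. pscale (c m) (f m)) - hpart j g \<in> ext_ideal"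
      using diff[of c] by (simp only:)
    from ideal_in_diff[OF ideal_ext_ideal ug this] have "u - (\<Sum>m\<in>?N. pscale (c m) (f m)) \<in> ext_ideal" by simp
    moreover have "u - (\<Sum>m\<in>?N. pscale (c m) (f m)) \<in> ?U"
      using u f(1) by (intro pscale.subspace_diff[OF subU] pscale.subspace_sum[OF subU] pscale.subspace_scale[OF subU]) auto
    ultimately show "\<exists>c. u - (\<Sum>m\<in>?N. pscale (c m) (f m)) \<in> ?W" using W by blast
  qed (use fM fN f in auto)
  then show ?thesis unfolding chow_dim_def by simp
qed

lemma augH_eq:
  "augH E rk = 1 + (\<Sum>G\<in>L. (\<Sum>a\<in>{1..<rk G + 1}. fps_X ^ a) * chow_series E rk G)"
proof -
  obtain N where N: "finite N" "monbasis (Inl ` L) (flat_ideal L 0) N"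
    "(\<Sum>m\<in>N. fps_X ^ mdeg m) = 1 + (\<Sum>G\<in>L. (\<Sum>a\<in>{1..<rk G + 1}. fps_X ^ a) * chow_series E rk G)"
    using flat_ideal_monbasis[OF upset_L, of 0] by auto
  have "monbasis all_vars ext_ideal N"
    unfolding ext_ideal_eq all_vars_def
  proof (rule monbasis_linear_adjoin[OF N(2) _ _ flat_gens_polys])
    show "lin_form v \<in> polys (Inl ` L)" if "v \<in> Inr ` E" for v
      using that by (auto simp: lin_form_def ysum_def intro!: polys_sum x_polys[of _ L])
  qed (auto simp: finite_E)
  then have "fps_nth (augH E rk) j = fps_nth (\<Sum>m\<in>N. fps_X ^ mdeg m) j" for j
  proof -
    assume "monbasis all_vars ext_ideal N"
    have "fps_nth (\<Sum>m\<in>N. (fps_X :: int fps) ^ mdeg m) j = (\<Sum>m\<in>N. if mdeg m = j then 1 else 0)"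
      by (simp add: fps_sum_nth fps_X_power_nth eq_commute)
    also have "\<dots> = int (card {m \<in> N. mdeg m = j})"
      using N(1) by (simp add: sum.If_cases Int_def)
    finally show ?thesis
      using chow_dim_eq[OF \<open>monbasis all_vars ext_ideal N\<close> N(1)] by (simp add: augH_def)
  qed
  then show ?thesis unfolding N(3)[symmetric] by (intro fps_ext)
qed

end

section \<open>The recursion\<close>

declare mobius.simps [simp del]

section \<open>Contraction by a flat\<close>

context loopless_matroid
begin

lemma contraction_union:
  assumes "F \<in> L" "X \<subseteq> E"
  shows "rk F \<le> rk (X \<union> F)" "X \<inter> F = {} \<Longrightarrow> rk (X \<union> F) \<le> rk X + rk F"
  using assms flat_subset[OF assms(1)] rk_mono[of F "X \<union> F"] submod[of X F] by auto

text \<open>Rank differences inherit submodularity because every rank involved is at least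
  \<open>rk F\<close>, so natural subtraction is exact. No loop arises because adding a point to a
  flat raises its rank.\<close>

lemma contraction:
  assumes F: "F \<in> L"
  shows "loopless_matroid (E - F) (contr_rk rk F)"
proof
  have FE: "F \<subseteq> E" by (rule flat_subset[OF F])
  have card: "rk X \<le> card X" if "X \<subseteq> E" for X using that matroid by (simp add: matroid_def)
  show "matroid (E - F) (contr_rk rk F)"
    unfolding matroid_def contr_rk_def
  proof (intro conjI allI impI)
    show "finite (E - F)" using finite_E by simp
  next
    fix X assume X: "X \<subseteq> E - F"
    then have "X \<subseteq> E" "X \<inter> F = {}" by auto
    then show "rk (X \<union> F) - rk F \<le> card X"
      using contraction_union(2)[OF F, of X] card[of X] by simp
  next
    fix X Y assume "X \<subseteq> Y" "Y \<subseteq> E - F"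
    then have "rk (X \<union> F) \<le> rk (Y \<union> F)" using FE by (intro rk_mono) auto
    then show "rk (X \<union> F) - rk F \<le> rk (Y \<union> F) - rk F" by (rule diff_le_mono)
  next
    fix X Y assume XY: "X \<subseteq> E - F" "Y \<subseteq> E - F"
    have "rk ((X \<union> F) \<union> (Y \<union> F)) + rk ((X \<union> F) \<inter> (Y \<union> F)) \<le> rk (X \<union> F) + rk (Y \<union> F)"
      using XY FE by (intro submod) auto
    moreover have "(X \<union> F) \<union> (Y \<union> F) = X \<union> Y \<union> F" "(X \<union> F) \<inter> (Y \<union> F) = X \<inter> Y \<union> F" by auto
    ultimately have "rk (X \<union> Y \<union> F) + rk (X \<inter> Y \<union> F) \<le> rk (X \<union> F) + rk (Y \<union> F)" by simp
    moreover have "rk F \<le> rk (X \<union> Y \<union> F)" "rk F \<le> rk (X \<inter> Y \<union> F)"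
      using XY by (auto intro!: contraction_union(1)[OF F])
    ultimately show "rk (X \<union> Y \<union> F) - rk F + (rk (X \<inter> Y \<union> F) - rk F)
        \<le> rk (X \<union> F) - rk F + (rk (Y \<union> F) - rk F)"
      by linarith
  qed
  show "loopless (E - F) (contr_rk rk F)"
    unfolding loopless_def contr_rk_def
  proof
    fix i assume i: "i \<in> E - F"
    then have "rk F < rk (insert i F)" using F by (auto simp: flats_def)
    moreover have "rk ({i} \<union> F) \<le> rk {i} + rk F" using i by (intro contraction_union(2)[OF F]) auto
    moreover have "rk {i} = 1" using i loopless by (simp add: loopless_def)
    ultimately show "rk ({i} \<union> F) - rk F = 1" by simp
  qed
qed

lemma contr_rk_diff: "F \<subseteq> G \<Longrightarrow> contr_rk rk F (G - F) = rk G - rk F"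
  by (simp add: contr_rk_def Un_absorb2)

lemma flats_contraction:
  assumes F: "F \<in> L"
  shows "flats (E - F) (contr_rk rk F) = (\<lambda>G. G - F) ` {G \<in> L. F \<subseteq> G}"
proof -
  have flat_iff: "X \<in> flats (E - F) (contr_rk rk F) \<longleftrightarrow> X \<union> F \<in> L" if X: "X \<subseteq> E - F" for X
  proof -
    have "rk (X \<union> F) - rk F < rk (insert e X \<union> F) - rk F \<longleftrightarrow> rk (X \<union> F) < rk (insert e (X \<union> F))"
      if "e \<in> E - F - X" for e
    proof -
      have "rk F \<le> rk (X \<union> F)" using X by (intro contraction_union(1)[OF F]) auto
      moreover have "insert e X \<union> F = insert e (X \<union> F)" by auto
      ultimately show ?thesis by (simp only:) linarith
    qed
    moreover have "E - (X \<union> F) = E - F - X" by auto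
    ultimately show ?thesis
      using X flat_subset[OF F] by (auto simp: flats_def contr_rk_def)
  qed
  show ?thesis
  proof (intro equalityI subsetI)
    fix X assume X: "X \<in> flats (E - F) (contr_rk rk F)"
    then have "X \<subseteq> E - F" by (simp add: flats_def)
    with X flat_iff[of X] have "X \<union> F \<in> {G \<in> L. F \<subseteq> G}" "X = X \<union> F - F" by auto
    then show "X \<in> (\<lambda>G. G - F) ` {G \<in> L. F \<subseteq> G}" by blast
  next
    fix X assume "X \<in> (\<lambda>G. G - F) ` {G \<in> L. F \<subseteq> G}"
    then obtain G where G: "G \<in> L" "F \<subseteq> G" "X = G - F" by blast
    then have "X \<subseteq> E - F" "X \<union> F = G" using flat_subset[of G] by auto
    with G(1) flat_iff[of X] show "X \<in> flats (E - F) (contr_rk rk F)" by simp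
  qed
qed

lemma inj_on_contraction: "inj_on (\<lambda>G. G - F) {G \<in> L. F \<subseteq> G}"
  by (intro inj_onI) blast

text \<open>The recursion sees only the flats above \<open>G\<close> and rank differences, and both
  are preserved by removing \<open>F\<close>.\<close>

lemma chow_series_contraction:
  assumes F: "F \<in> L" and G: "G \<in> L" "F \<subseteq> G"
  shows "chow_series (E - F) (contr_rk rk F) (G - F) = chow_series E rk G"
  using G
proof (induction "card (E - G)" arbitrary: G rule: less_induct)
  case less
  have sub: "{K \<in> L. G \<subset> K} \<subseteq> {K \<in> L. F \<subseteq> K}" using less.prems by auto
  have "{K \<in> flats (E - F) (contr_rk rk F). G - F \<subset> K} = (\<lambda>K. K - F) ` {K \<in> L. G \<subset> K}"
    unfolding flats_contraction[OF F] using less.prems by blast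
  then have "chow_series (E - F) (contr_rk rk F) (G - F) = 1 + (\<Sum>K\<in>(\<lambda>K. K - F) ` {K \<in> L. G \<subset> K}.
      (\<Sum>a\<in>{1..<contr_rk rk F K - contr_rk rk F (G - F)}. fps_X ^ a) * chow_series (E - F) (contr_rk rk F) K)"
    using finite_E by (subst chow_series.simps) simp
  also have "\<dots> = 1 + (\<Sum>K\<in>{K \<in> L. G \<subset> K}. (\<Sum>a\<in>{1..<rk K - rk G}. fps_X ^ a) * chow_series E rk K)"
  proof (subst sum.reindex[OF inj_on_subset[OF inj_on_contraction sub]], intro arg_cong[of _ _ "(+) 1"] sum.cong refl)
    fix K assume K: "K \<in> {K \<in> L. G \<subset> K}"
    then have FK: "F \<subseteq> K" "K \<subseteq> E" "K \<in> L" using less.prems flat_subset by auto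
    have "card (E - K) < card (E - G)"
      using K FK finite_E by (intro psubset_card_mono) auto
    then have IH: "chow_series (E - F) (contr_rk rk F) (K - F) = chow_series E rk K"
      using FK by (intro less.hyps) auto
    have "contr_rk rk F (K - F) - contr_rk rk F (G - F) = rk K - rk G"
      using FK less.prems flat_rk_le[of F G] by (simp add: contr_rk_diff)
    then show "((\<lambda>K'. (\<Sum>a\<in>{1..<contr_rk rk F K' - contr_rk rk F (G - F)}. fps_X ^ a) * chow_series (E - F) (contr_rk rk F) K')
        \<circ> (\<lambda>K. K - F)) K = (\<Sum>a\<in>{1..<rk K - rk G}. fps_X ^ a) * chow_series E rk K"
      using IH by simp
  qed
  also have "\<dots> = chow_series E rk G" using finite_E by (subst (2) chow_series.simps) simp
  finally show ?case .
qed

end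

section \<open>Identities of Hilbert series and Moebius inversion\<close>

lemma fps_const_sum: "fps_const (sum f A) = (\<Sum>a\<in>A. fps_const (f a))"
  by (induction A rule: infinite_finite_induct) (simp_all flip: fps_const_add)

lemma geometric_int_fps:
  "n \<ge> 1 \<Longrightarrow> (1 - fps_X) * (\<Sum>a\<in>{1..<n}. fps_X ^ a) = (fps_X - fps_X ^ n :: int fps)"
proof (induction n rule: nat_induct_at_least)
  case (Suc n)
  then show ?case by (simp add: distrib_left left_diff_distrib)
qed simp

context loopless_matroid
begin

text \<open>This is the defining recursion of \<open>chow_series\<close> multiplied by
  \<open>1 - x\<close>, which turns each geometric sum into \<open>x - x ^ (rk G - rk F)\<close>;
  the term of \<open>F\<close> itself is then absorbed on both sides.\<close>

lemma chow_series_sum: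
  assumes F: "F \<in> L"
  shows "(\<Sum>G\<in>{G \<in> L. F \<subseteq> G}. fps_X ^ (rk G - rk F) * chow_series E rk G)
    = fps_X * (\<Sum>G\<in>{G \<in> L. F \<subseteq> G}. chow_series E rk G) + 1 - fps_X"
proof -
  let ?C = "chow_series E rk"
  have split: "{G \<in> L. F \<subseteq> G} = insert F {G \<in> L. F \<subset> G}" using F by auto
  have fin: "finite {G \<in> L. F \<subset> G}" using finite_L by simp
  define u where "u n = (\<Sum>a\<in>{1..<n}. (fps_X :: int fps) ^ a)" for n :: nat
  have "?C F = 1 + (\<Sum>G\<in>{G \<in> L. F \<subset> G}. u (rk G - rk F) * ?C G)"
    using finite_E by (subst chow_series.simps) (simp add: u_def)
  then have "(1 - fps_X) * ?C F = (1 - fps_X)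
      + (\<Sum>G\<in>{G \<in> L. F \<subset> G}. (1 - fps_X) * u (rk G - rk F) * ?C G)"
    by (simp add: distrib_left sum_distrib_left mult.assoc)
  also have "(\<Sum>G\<in>{G \<in> L. F \<subset> G}. (1 - fps_X) * u (rk G - rk F) * ?C G)
      = (\<Sum>G\<in>{G \<in> L. F \<subset> G}. (fps_X - fps_X ^ (rk G - rk F)) * ?C G)"
  proof (intro sum.cong refl)
    fix G assume "G \<in> {G \<in> L. F \<subset> G}"
    then have "rk F < rk G" using flat_rk_less[OF F] by auto
    then show "(1 - fps_X) * u (rk G - rk F) * ?C G = (fps_X - fps_X ^ (rk G - rk F)) * ?C G"
      unfolding u_def by (subst geometric_int_fps) auto
  qed
  finally have "(1 - fps_X) * ?C F = (1 - fps_X)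
      + (\<Sum>G\<in>{G \<in> L. F \<subset> G}. (fps_X - fps_X ^ (rk G - rk F)) * ?C G)" .
  then show ?thesis
    unfolding split using fin
    by (simp add: algebra_simps sum_subtractf sum_distrib_left)
qed

text \<open>Multiplying \<open>augH_eq\<close> for the contraction by \<open>1 - x\<close> gives
  \<open>1 - x\<close> plus \<open>x\<close> times the difference of \<open>?D\<close> and
  \<open>?T\<close>; by \<open>chow_series_sum\<close> this is \<open>(1 - x) ?T\<close>, and
  \<open>1 - x\<close> cancels in a domain.\<close>

lemma augH_contraction:
  assumes F: "F \<in> L"
  shows "augH (E - F) (contr_rk rk F) = (\<Sum>G\<in>{G \<in> L. F \<subseteq> G}. fps_X ^ (rk G - rk F) * chow_series E rk G)"
    (is "_ = ?T")
proof -
  interpret c: loopless_matroid "E - F" "contr_rk rk F" by (rule contraction[OF F])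
  let ?C = "chow_series E rk"
  let ?D = "\<Sum>G\<in>{G \<in> L. F \<subseteq> G}. ?C G"
  define u where "u n = (\<Sum>a\<in>{1..<n}. (fps_X :: int fps) ^ a)" for n :: nat
  have "augH (E - F) (contr_rk rk F) = 1 + (\<Sum>G\<in>(\<lambda>G. G - F) ` {G \<in> L. F \<subseteq> G}.
      (\<Sum>a\<in>{1..<contr_rk rk F G + 1}. fps_X ^ a) * chow_series (E - F) (contr_rk rk F) G)"
    using c.augH_eq by (simp only: flats_contraction[OF F])
  also have "\<dots> = 1 + (\<Sum>G\<in>{G \<in> L. F \<subseteq> G}. (\<Sum>a\<in>{1..<rk G - rk F + 1}. fps_X ^ a) * ?C G)"
    using contr_rk_diff[of F] chow_series_contraction[OF F]
    by (subst sum.reindex[OF inj_on_contraction]) (auto intro!: sum.cong)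
  finally have H: "augH (E - F) (contr_rk rk F)
    = 1 + (\<Sum>G\<in>{G \<in> L. F \<subseteq> G}. u (rk G - rk F + 1) * ?C G)"
    by (simp only: u_def)
  have "(1 - fps_X) * augH (E - F) (contr_rk rk F) = (1 - fps_X)
      + (\<Sum>G\<in>{G \<in> L. F \<subseteq> G}. (1 - fps_X) * u (rk G - rk F + 1) * ?C G)"
    unfolding H by (simp add: distrib_left sum_distrib_left mult.assoc)
  also have "(\<Sum>G\<in>{G \<in> L. F \<subseteq> G}. (1 - fps_X) * u (rk G - rk F + 1) * ?C G)
      = (\<Sum>G\<in>{G \<in> L. F \<subseteq> G}. fps_X * ?C G - fps_X * (fps_X ^ (rk G - rk F) * ?C G))"
    unfolding u_def by (intro sum.cong refl, subst geometric_int_fps) (simp_all add: algebra_simps)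
  also have "\<dots> = fps_X * ?D - fps_X * ?T"
    by (simp add: sum_subtractf sum_distrib_left)
  also have "(1 - fps_X) + (fps_X * ?D - fps_X * ?T) = (1 - fps_X) * ?T"
    using chow_series_sum[OF F] by (simp add: algebra_simps)
  finally have "(1 - fps_X) * augH (E - F) (contr_rk rk F) = (1 - fps_X) * ?T" .
  moreover have "(1 - fps_X :: int fps) \<noteq> 0"
    by (metis diff_0_right fps_X_neq_one right_minus_eq)
  ultimately show ?thesis by simp
qed

lemma mobius_sum:
  assumes G: "G \<in> L"
  shows "(\<Sum>F\<in>{F \<in> L. F \<subseteq> G}. mobius L {} F) = (if G = {} then 1 else 0)"
proof (cases "G = {}")
  case True
  then have "{F \<in> L. F \<subseteq> G} = {{}}" using empty_flat by auto
  then show ?thesis using True by (simp add: mobius.simps)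
next
  case False
  have "finite G" using flat_subset[OF G] finite_E finite_subset by blast
  then have "mobius L {} G = - (\<Sum>Z\<in>{Z \<in> L. Z \<subset> G}. mobius L {} Z)"
    using False by (subst mobius.simps) auto
  moreover have "{F \<in> L. F \<subseteq> G} = insert G {Z \<in> L. Z \<subset> G}" using G by auto
  ultimately show ?thesis using False finite_L by simp
qed

text \<open>Moebius inversion at the bottom: after exchanging the sums, \<open>f G\<close> is
  weighted by the Moebius sum below \<open>G\<close>, which vanishes unless \<open>G\<close> is
  empty.\<close>

lemma mobius_sum_above:
  "(\<Sum>F\<in>L. fps_const (mobius L {} F) * (\<Sum>G\<in>{G \<in> L. F \<subseteq> G}. f G)) = f {}"
proof -
  have "(\<Sum>F\<in>L. fps_const (mobius L {} F) * (\<Sum>G\<in>{G \<in> L. F \<subseteq> G}. f G))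
    = (\<Sum>F\<in>L. \<Sum>G\<in>{G \<in> L. F \<subseteq> G}. fps_const (mobius L {} F) * f G)"
    by (simp add: sum_distrib_left)
  also have "\<dots> = (\<Sum>G\<in>L. \<Sum>F\<in>{F \<in> L. F \<subseteq> G}. fps_const (mobius L {} F) * f G)"
    by (rule sum.swap_restrict[OF finite_L finite_L])
  also have "\<dots> = (\<Sum>G\<in>L. fps_const (\<Sum>F\<in>{F \<in> L. F \<subseteq> G}. mobius L {} F) * f G)"
    by (simp add: sum_distrib_right fps_const_sum)
  also have "\<dots> = (\<Sum>G\<in>L. if G = {} then f G else 0)"
    by (intro sum.cong) (auto simp: mobius_sum)
  also have "\<dots> = f {}" using finite_L empty_flat by simp
  finally show ?thesis .
qed

lemma augH_recursion:
  assumes "E \<noteq> {}"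
  shows "augH E rk = aug_rec_rhs augH E rk"
proof -
  let ?C = "chow_series E rk"
  define mu where "mu F = fps_const (mobius L {} F)" for F
  define H where "H F = augH (E - F) (contr_rk rk F)" for F
  define q where "q F = (\<Sum>k\<le>rk F. (fps_X :: int fps) ^ k)" for F
  have q: "(1 - fps_X) * q F = 1 - fps_X ^ (rk F + 1)" for F
  proof -
    have "q F = 1 + (\<Sum>a\<in>{1..<rk F + 1}. fps_X ^ a)"
      unfolding q_def lessThan_Suc_atMost[symmetric] by (simp add: sum.lessThan_Suc_shift sum.atLeast_Suc_lessThan lessThan_atLeast0)
    then have "(1 - fps_X) * q F = (1 - fps_X) + (fps_X - fps_X ^ (rk F + 1))"
      using geometric_int_fps[of "rk F + 1"] by (simp only: distrib_left) simp
    then show ?thesis by simp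
  qed
  have "H F = (\<Sum>G\<in>{G \<in> L. F \<subseteq> G}. fps_X * ?C G) + (1 - fps_X)" if "F \<in> L" for F
    unfolding H_def augH_contraction[OF that] chow_series_sum[OF that] sum_distrib_left by simp
  then have "(\<Sum>F\<in>L. mu F * H F) = (\<Sum>F\<in>L. mu F * (\<Sum>G\<in>{G \<in> L. F \<subseteq> G}. fps_X * ?C G)) + (\<Sum>F\<in>L. mu F) * (1 - fps_X)"
    unfolding sum_distrib_right sum.distrib[symmetric]
    by (intro sum.cong refl) (simp only: distrib_left)
  \<comment> \<open>The summand \<open>1 - x\<close> of each \<open>H F\<close> is weighted by the
    full Moebius sum, which is zero precisely because the ground set is nonempty.\<close>
  also have "(\<Sum>F\<in>L. mu F) = fps_const (\<Sum>F\<in>{F \<in> L. F \<subseteq> E}. mobius L {} F)"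
    unfolding mu_def fps_const_sum using flat_subset by (intro sum.cong) auto
  also have "\<dots> = 0" using mobius_sum[OF E_flat] assms by simp
  finally have 1: "(\<Sum>F\<in>L. mu F * H F) = fps_X * ?C {}"
    using mobius_sum_above[of "\<lambda>G. fps_X * ?C G"] by (simp add: mu_def)
  \<comment> \<open>The factor makes the exponent \<open>rk G + 1\<close> independent of
    \<open>F\<close>, as inversion requires.\<close>
  have "fps_X ^ (rk F + 1) * H F = (\<Sum>G\<in>{G \<in> L. F \<subseteq> G}. fps_X ^ (rk G + 1) * ?C G)" if F: "F \<in> L" for F
  proof -
    have "fps_X ^ (rk F + 1) * (fps_X ^ (rk G - rk F) * ?C G) = fps_X ^ (rk G + 1) * ?C G"
      if "G \<in> {G \<in> L. F \<subseteq> G}" for G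
    proof -
      have "rk F + 1 + (rk G - rk F) = rk G + 1" using that flat_rk_le[of F G] by simp
      then show ?thesis by (metis mult.assoc power_add)
    qed
    then show ?thesis unfolding H_def augH_contraction[OF F] sum_distrib_left by (intro sum.cong) auto
  qed
  then have "(\<Sum>F\<in>L. mu F * (fps_X ^ (rk F + 1) * H F))
      = (\<Sum>F\<in>L. mu F * (\<Sum>G\<in>{G \<in> L. F \<subseteq> G}. fps_X ^ (rk G + 1) * ?C G))"
    by (intro sum.cong) auto
  also have "\<dots> = fps_X * ?C {}"
    unfolding mu_def mobius_sum_above by simp
  finally have 2: "(\<Sum>F\<in>L. mu F * (fps_X ^ (rk F + 1) * H F)) = fps_X * ?C {}" .
  have "(1 - fps_X) * (\<Sum>F\<in>L. mu F * q F * H F) = (\<Sum>F\<in>L. mu F * ((1 - fps_X) * q F) * H F)"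
    by (simp add: sum_distrib_left mult_ac)
  also have "\<dots> = (\<Sum>F\<in>L. mu F * H F) - (\<Sum>F\<in>L. mu F * (fps_X ^ (rk F + 1) * H F))"
    unfolding q sum_subtractf[symmetric] by (intro sum.cong) (simp_all add: algebra_simps)
  also have "\<dots> = 0" using 1 2 by simp
  finally have "(1 - fps_X) * (\<Sum>F\<in>L. mu F * q F * H F) = 0" .
  moreover have "(1 - fps_X :: int fps) \<noteq> 0"
    by (metis diff_0_right fps_X_neq_one right_minus_eq)
  ultimately have "(\<Sum>F\<in>L. mu F * q F * H F) = 0" by simp
  then have "mu {} * q {} * H {} + (\<Sum>F\<in>L - {{}}. mu F * q F * H F) = 0"
    using sum.remove[OF finite_L empty_flat] by metis
  \<comment> \<open>The term of the empty flat is the unknown itself: Moebius value 1, trivial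
    geometric sum, and contraction by the empty set changes nothing.\<close>
  moreover have "mu {} * q {} * H {} = augH E rk"
    by (simp add: mu_def q_def H_def mobius.simps contr_rk_def)
  ultimately show ?thesis
    unfolding aug_rec_rhs_def by (simp add: mu_def q_def H_def eq_neg_iff_add_eq_0)
qed

end

section \<open>The empty matroid and uniqueness\<close>

lemma augH_empty:
  assumes "matroid {} rk"
  shows "augH {} rk = 1"
proof -
  interpret loopless_matroid "{}" rk using assms by unfold_locales (simp_all add: loopless_def)
  have "flats {} rk = {{}}" by (auto simp: flats_def)
  then show ?thesis using augH_eq by simp
qed

text \<open>The right-hand side evaluates \<open>G\<close> only at contractions by nonempty flats,
  which are loopless matroids on smaller ground sets; induction on the size of \<open>E\<close>
  applies.\<close>

lemma aug_rec_unique: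
  assumes empty: "\<And>rk. matroid {} rk \<Longrightarrow> G {} rk = 1"
    and rec: "\<And>E rk. matroid E rk \<Longrightarrow> loopless E rk \<Longrightarrow> E \<noteq> {} \<Longrightarrow> G E rk = aug_rec_rhs G E rk"
    and "matroid E rk" "loopless E rk"
  shows "G E rk = augH E rk"
  using assms(3,4)
proof (induction "card E" arbitrary: E rk rule: less_induct)
  case less
  interpret loopless_matroid E rk using less.prems by unfold_locales
  show ?case
  proof (cases "E = {}")
    case True
    then show ?thesis using less.prems empty augH_empty by simp
  next
    case False
    have "G (E - F) (contr_rk rk F) = augH (E - F) (contr_rk rk F)" if F: "F \<in> L - {{}}" for F
    proof -
      interpret c: loopless_matroid "E - F" "contr_rk rk F" using F by (intro contraction) auto
      have "card (E - F) < card E"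
        using F flat_subset[of F] finite_E by (intro psubset_card_mono) auto
      then show ?thesis using c.matroid c.loopless by (rule less.hyps)
    qed
    then have "aug_rec_rhs G E rk = aug_rec_rhs augH E rk"
      unfolding aug_rec_rhs_def by (intro arg_cong[of _ _ uminus] sum.cong) auto
    then show ?thesis using rec[OF less.prems False] augH_recursion[OF False] by simp
  qed
qed

theorem theorem3p14:
  shows "(\<forall>(E :: 'a set) rk. matroid E rk \<and> loopless E rk \<and> E \<noteq> {} \<longrightarrow>
            augH E rk = aug_rec_rhs augH E rk)
       \<and> (\<forall>rk :: 'a set \<Rightarrow> nat. matroid {} rk \<longrightarrow> augH {} rk = 1)
       \<and> (\<forall>G :: 'a set \<Rightarrow> ('a set \<Rightarrow> nat) \<Rightarrow> int fps.
            (\<forall>rk. matroid {} rk \<longrightarrow> G {} rk = 1)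
            \<and> (\<forall>E rk. matroid E rk \<and> loopless E rk \<and> E \<noteq> {} \<longrightarrow> G E rk = aug_rec_rhs G E rk)
            \<longrightarrow> (\<forall>E rk. matroid E rk \<and> loopless E rk \<longrightarrow> G E rk = augH E rk))"
proof (intro conjI allI impI)
  fix E :: "'a set" and rk assume "matroid E rk \<and> loopless E rk \<and> E \<noteq> {}"
  then show "augH E rk = aug_rec_rhs augH E rk"
    by (intro loopless_matroid.augH_recursion loopless_matroid.intro) auto
next
  fix rk :: "'a set \<Rightarrow> nat" assume "matroid {} rk"
  then show "augH {} rk = 1" by (rule augH_empty)
next
  fix G :: "'a set \<Rightarrow> ('a set \<Rightarrow> nat) \<Rightarrow> int fps" and E :: "'a set" and rk
  assume "(\<forall>rk. matroid {} rk \<longrightarrow> G {} rk = 1)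
    \<and> (\<forall>E rk. matroid E rk \<and> loopless E rk \<and> E \<noteq> {} \<longrightarrow> G E rk = aug_rec_rhs G E rk)"
    and "matroid E rk \<and> loopless E rk"
  then show "G E rk = augH E rk" by (intro aug_rec_unique[of G]) auto
qed

end
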